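(* Let $\Omega$, $H$, $\mathcal{C}$, $N$, $\alpha_{n,l}$, $U_{n,l}$, $w_{n,l}$ and the operators $T_{n,l}$ on $C_0(\Omega,\mathcal{C})$ ($n\in\mathbb{N}$, $l\in\{1,\dots,N\}$) be as in the context, and let $\mathcal{F}$ be the family of all infinite subsets of $\mathbb{N}$. Suppose that there exist dense subsets $H_0,H_1,\dots,H_N$ of $H$ such that for all $s,l\in\{1,\dots,N\}$ and every compact subset $K$ of $\Omega$ $$\lim_{n\to\infty}\left[\left(\sup_{x\in K}\|w_{n,s}^{-1}(x)h_s\|\right)\cdot\left(\sup_{y\in K}\|(w_{n,l}\circ\alpha_{n,l}^{-1})(y)h_0\|\right)\right]=0$$ for every $h_s\in H_s$ and $h_0\in H_0$, and, in addition, for all distinct $s,l\in\{1,\dots,N\}$, every compact subset $K$ of $\Omega$ and every $h_s\in H_s$ $$\lim_{n\to\infty}\left(\sup_{x\in K}\|(w_{n,l}\circ\alpha_{n,l}^{-1}\circ\alpha_{n,s})(x)\,w_{n,s}^{-1}(x)\,h_s\|\right)=0 .$$ Then the families $\{T_{n,1}\}_{n\in\mathbb{N}},\dots,\{T_{n,N}\}_{n\in\mathbb{N}}$ are $d\mathcal{F}$-semi-transitive on $C_0(\Omega,\mathcal{C})$.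
   Context: $\Omega$ is a locally compact, non-compact Hausdorff space; $H$ is a separable Hilbert space with an orthonormal basis $\{e_j\}_{j\in\mathbb{Z}}$; $B(H)$ is the algebra of bounded linear operators on $H$ and $\mathcal{C}$ the $C^*$-algebra of compact operators on $H$. $C_0(\Omega,\mathcal{C})$ is the algebra of all continuous $\mathcal{C}$-valued functions on $\Omega$ vanishing at infinity, with norm $\|f\|_\infty=\sup_{x\in\Omega}\|f(x)\|$; $C_b(\Omega,B(H))$ is the algebra of all uniformly bounded continuous $B(H)$-valued functions on $\Omega$ with the same norm. $N\in\mathbb{N}$. For $n\in\mathbb{N}$ and $l\in\{1,\dots,N\}$: $\alpha_{n,l}$ is a homeomorphism of $\Omega$, $U_{n,l}$ is a unitary operator on $H$, and $w_{n,l}\in C_b(\Omega,B(H))$ is such that $w_{n,l}(x)$ is invertible for all $x\in\Omega$ and $w_{n,l}^{-1}$, defined by $w_{n,l}^{-1}(x)=(w_{n,l}(x))^{-1}$, also belongs to $C_b(\Omega,B(H))$, i.e. $\sup_{x\in\Omega}\|w_{n,l}^{-1}(x)\|<\infty$. Put $\Phi_{n,l}(f)=U_{n,l}^*(f\circ\alpha_{n,l})U_{n,l}$ and $b_{n,l}=w_{n,l}U_{n,l}$. The operator $T_{n,l}$ on $C_0(\Omega,\mathcal{C})$ is $T_{n,l}(f)=b_{n,l}\,\Phi_{n,l}(f)$, i.e. $T_{n,l}(f)(x)=w_{n,l}(x)\,f(\alpha_{n,l}(x))\,U_{n,l}$. Definition. Families $\{T_{n,1}\}_{n\in\mathbb{N}},\dots,\{T_{n,N}\}_{n\in\mathbb{N}}$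 of bounded linear operators on a Banach space $X$ are $d\mathcal{F}$-semi-transitive if for all non-empty open subsets $\mathcal{O},V_1,\dots,V_N$ of $X$ there is some $F\in\mathcal{F}$ such that for every $n\in F$ there is a real $\lambda_n>0$ with $$\mathcal{O}\cap\lambda_nT_{n,1}^{-1}(V_1)\cap\dots\cap\lambda_nT_{n,N}^{-1}(V_N)\neq\varnothing,$$ where $T_{n,l}^{-1}(V_l)$ denotes the preimage. *)

theory Defs
  imports "HOL-Analysis.Analysis"
begin

section \<open>Complex Hilbert spaces\<close>

(* HOL-Analysis only has real inner product spaces.  A complex Hilbert space is a complete real
   inner product space (the real inner product being the real part of the complex one, so that
   norm and topology are those of the library) with a compatible complex scalar multiplication and
   a sesquilinear product, linear in the first argument. *)
class complex_hilbert = real_inner + complete_space +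
  fixes scaleC :: "complex \<Rightarrow> 'a \<Rightarrow> 'a" (infixr \<open>*\<^sub>C\<close> 75)
    and cinner :: "'a \<Rightarrow> 'a \<Rightarrow> complex"
  assumes scaleC_add_right: "c *\<^sub>C (x + y) = c *\<^sub>C x + c *\<^sub>C y"
    and scaleC_add_left: "(c + d) *\<^sub>C x = c *\<^sub>C x + d *\<^sub>C x"
    and scaleC_scaleC: "c *\<^sub>C (d *\<^sub>C x) = (c * d) *\<^sub>C x"
    and scaleR_scaleC: "r *\<^sub>R x = complex_of_real r *\<^sub>C x"
    and cinner_commute: "cinner x y = cnj (cinner y x)"
    and cinner_add_left: "cinner (x + y) z = cinner x z + cinner y z"
    and cinner_scaleC_left: "cinner (c *\<^sub>C x) y = c * cinner x y"
    and inner_eq_Re_cinner: "inner x y = Re (cinner x y)"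

lemma vector_space_scaleC:
  "vector_space (scaleC :: complex \<Rightarrow> 'h::complex_hilbert \<Rightarrow> 'h)"
proof
  fix x :: 'h
  show "1 *\<^sub>C x = x"
    using scaleR_scaleC[of 1 x] by simp
qed (simp_all add: scaleC_add_right scaleC_add_left scaleC_scaleC)

definition orthonormal_basis :: "('i \<Rightarrow> 'h::complex_hilbert) \<Rightarrow> bool" where
  "orthonormal_basis e \<longleftrightarrow>
     (\<forall>i j. cinner (e i) (e j) = (if i = j then 1 else 0)) \<and>
     closure (module.span scaleC (range e)) = UNIV"

section \<open>Operators\<close>

(* The type of bounded operators of the library consists of the real-linear ones; B(H) is the set
   of those which are complex-linear.  The operator norm is the same. *)
definition BH :: "('h::complex_hilbert \<Rightarrow>\<^sub>L 'h) set" where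
  "BH = {A. \<forall>c x. blinfun_apply A (c *\<^sub>C x) = c *\<^sub>C blinfun_apply A x}"

definition compact_ops :: "('h::complex_hilbert \<Rightarrow>\<^sub>L 'h) set" where
  "compact_ops = {A \<in> BH. compact (closure (blinfun_apply A ` cball 0 1))}"

definition invertible_op :: "('h::complex_hilbert \<Rightarrow>\<^sub>L 'h) \<Rightarrow> bool" where
  "invertible_op A \<longleftrightarrow> (\<exists>B\<in>BH. A o\<^sub>L B = id_blinfun \<and> B o\<^sub>L A = id_blinfun)"

definition op_inverse :: "('h::complex_hilbert \<Rightarrow>\<^sub>L 'h) \<Rightarrow> ('h \<Rightarrow>\<^sub>L 'h)" where
  "op_inverse A = (THE B. A o\<^sub>L B = id_blinfun \<and> B o\<^sub>L A = id_blinfun)"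

definition op_adjoint :: "('h::complex_hilbert \<Rightarrow>\<^sub>L 'h) \<Rightarrow> ('h \<Rightarrow>\<^sub>L 'h)" where
  "op_adjoint A = (THE B. \<forall>x y. cinner (blinfun_apply A x) y = cinner x (blinfun_apply B y))"

definition unitary_op :: "('h::complex_hilbert \<Rightarrow>\<^sub>L 'h) \<Rightarrow> bool" where
  "unitary_op U \<longleftrightarrow> U \<in> BH \<and> surj (blinfun_apply U) \<and>
     (\<forall>x y. cinner (U x) (U y) = cinner x y)"

lemma op_inverse_eqI:
  assumes "A o\<^sub>L B = id_blinfun" "B o\<^sub>L A = id_blinfun"
  shows "op_inverse A = B"
  unfolding op_inverse_def
proof (rule the_equality)
  fix C assume C: "A o\<^sub>L C = id_blinfun \<and> C o\<^sub>L A = id_blinfun"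
  show "C = B"
  proof (rule blinfun_eqI)
    fix x
    have "blinfun_apply C x = blinfun_apply (B o\<^sub>L A) (blinfun_apply C x)"
      using assms by simp
    also have "\<dots> = blinfun_apply B (blinfun_apply (A o\<^sub>L C) x)" by simp
    also have "\<dots> = blinfun_apply B x"
      using C by (simp del: blinfun_apply_blinfun_compose)
    finally show "blinfun_apply C x = blinfun_apply B x" .
  qed
qed (use assms in simp)

lemma op_adjoint_eqI:
  fixes A B :: "'h::complex_hilbert \<Rightarrow>\<^sub>L 'h"
  assumes "\<And>x y. cinner (A x) y = cinner x (B y)"
  shows "op_adjoint A = B"
  unfolding op_adjoint_def
proof (rule the_equality)
  fix C :: "'h \<Rightarrow>\<^sub>L 'h" assume C: "\<forall>x y. cinner (A x) y = cinner x (C y)"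
  show "C = B"
  proof (rule blinfun_eqI)
    fix y
    have "inner x (C y) = inner x (B y)" for x
      using C assms by (simp add: inner_eq_Re_cinner)
    then show "blinfun_apply C y = blinfun_apply B y"
      using vector_eq_ldot[of "C y" "B y"] by simp
  qed
qed (use assms in simp)

lemma unitary_op_adjoint:
  fixes U :: "'h::complex_hilbert \<Rightarrow>\<^sub>L 'h"
  assumes "unitary_op U"
  shows "U o\<^sub>L op_adjoint U = id_blinfun" "op_adjoint U o\<^sub>L U = id_blinfun"
    "op_adjoint U \<in> BH"
proof -
  have U: "U \<in> BH" "surj (blinfun_apply U)" "\<And>x y. cinner (U x) (U y) = cinner x y"
    using assms by (auto simp: unitary_op_def)
  have nrm: "norm (blinfun_apply U x) = norm x" for x
    by (simp add: norm_eq_sqrt_inner inner_eq_Re_cinner U)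
  have inj: "inj (blinfun_apply U)"
  proof (rule injI)
    fix x y assume "blinfun_apply U x = blinfun_apply U y"
    then have "norm (blinfun_apply U (x - y)) = 0"
      by (simp add: blinfun.diff_right)
    then show "x = y"
      by (simp add: nrm)
  qed
  define V where "V = inv (blinfun_apply U)"
  have UV: "blinfun_apply U (V x) = x" and VU: "V (blinfun_apply U x) = x" for x
    using U(2) inj by (auto simp: V_def surj_f_inv_f)
  have blV: "bounded_linear V"
  proof (rule bounded_linear_intro[where K = 1])
    show "V (x + y) = V x + V y" for x y
      by (metis UV VU blinfun.add_right)
    show "V (r *\<^sub>R x) = r *\<^sub>R V x" for r x
      by (metis UV VU blinfun.scaleR_right)
    show "norm (V x) \<le> norm x * 1" for x
      by (metis UV nrm mult.right_neutral order_refl)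
  qed
  have "cinner (U x) y = cinner x (Blinfun V y)" for x y
    by (metis U(3) UV blV bounded_linear_Blinfun_apply)
  then have adj: "op_adjoint U = Blinfun V"
    by (rule op_adjoint_eqI)
  show "U o\<^sub>L op_adjoint U = id_blinfun" "op_adjoint U o\<^sub>L U = id_blinfun"
    unfolding adj
    by (auto intro!: blinfun_eqI simp: bounded_linear_Blinfun_apply[OF blV] UV VU)
  have "V (c *\<^sub>C x) = c *\<^sub>C V x" for c x
    using U(1) by (metis (mono_tags, lifting) BH_def UV VU mem_Collect_eq)
  then show "op_adjoint U \<in> BH"
    by (simp add: adj BH_def bounded_linear_Blinfun_apply[OF blV])
qed

lemma compact_closure_subset:
  fixes S :: "'b::t2_space set"
  assumes "T \<subseteq> S" "compact S"
  shows "compact (closure T)"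
proof -
  have "closure T \<subseteq> S"
    using assms by (intro closure_minimal compact_imp_closed)
  then have "closure T = S \<inter> closure T"
    by blast
  then show ?thesis
    using compact_Int_closed[OF assms(2) closed_closure, of T] by simp
qed

lemma BH_compose: "A \<in> BH \<Longrightarrow> B \<in> BH \<Longrightarrow> A o\<^sub>L B \<in> BH"
  by (simp add: BH_def)

lemma compact_ops_compose_left:
  assumes "A \<in> BH" "B \<in> compact_ops"
  shows "A o\<^sub>L B \<in> compact_ops"
proof -
  let ?S = "closure (blinfun_apply B ` cball 0 1)"
  have "compact ?S"
    using assms(2) by (simp add: compact_ops_def)
  then have "compact (blinfun_apply A ` ?S)"
    by (intro compact_continuous_image linear_continuous_on blinfun.bounded_linear_right)
  moreover have "blinfun_apply (A o\<^sub>L B) ` cball 0 1 \<subseteq> blinfun_apply A ` ?S"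
    using closure_subset[of "blinfun_apply B ` cball 0 1"] by auto
  ultimately have "compact (closure (blinfun_apply (A o\<^sub>L B) ` cball 0 1))"
    by (intro compact_closure_subset)
  moreover have "A o\<^sub>L B \<in> BH"
    using assms by (intro BH_compose) (auto simp: compact_ops_def)
  ultimately show ?thesis
    by (simp add: compact_ops_def)
qed

lemma compact_ops_compose_unitary:
  assumes "B \<in> compact_ops" "unitary_op U"
  shows "B o\<^sub>L U \<in> compact_ops"
proof -
  have "norm (blinfun_apply U x) = norm x" for x
    using assms(2) by (simp add: norm_eq_sqrt_inner inner_eq_Re_cinner unitary_op_def)
  then have "blinfun_apply (B o\<^sub>L U) ` cball 0 1 \<subseteq> blinfun_apply B ` cball 0 1"
    by auto
  also have "\<dots> \<subseteq> closure (blinfun_apply B ` cball 0 1)"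
    by (rule closure_subset)
  finally have "compact (closure (blinfun_apply (B o\<^sub>L U) ` cball 0 1))"
  proof (rule compact_closure_subset)
    show "compact (closure (blinfun_apply B ` cball 0 1))"
      using assms(1) by (simp add: compact_ops_def)
  qed
  moreover have "B o\<^sub>L U \<in> BH"
    using assms by (intro BH_compose) (simp_all add: compact_ops_def unitary_op_def)
  ultimately show ?thesis
    by (simp add: compact_ops_def)
qed

section \<open>Operator-valued functions\<close>

definition Cb_BH :: "('a::topological_space \<Rightarrow> ('h::complex_hilbert \<Rightarrow>\<^sub>L 'h)) set" where
  "Cb_BH = {w \<in> bcontfun. range w \<subseteq> BH}"

(* As a subset of the library's type of bounded continuous functions, whose norm is the supremum
   norm; a continuous function vanishing at infinity is bounded. *)
definition C0 :: "('a::topological_space \<Rightarrow>\<^sub>C ('h::complex_hilbert \<Rightarrow>\<^sub>L 'h)) set" where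
  "C0 = {f. range (apply_bcontfun f) \<subseteq> compact_ops \<and>
     (\<forall>\<epsilon>>0. \<exists>K. compact K \<and> (\<forall>x. x \<notin> K \<longrightarrow> norm (apply_bcontfun f x) < \<epsilon>))}"

(* Bcontfun turns a function into an element of the type of bounded continuous functions; its
   arguments below are bounded and continuous whenever \<alpha> is continuous and w is in Cb_BH. *)
definition Phi :: "('h::complex_hilbert \<Rightarrow>\<^sub>L 'h) \<Rightarrow> ('a::topological_space \<Rightarrow> 'a) \<Rightarrow>
    ('a \<Rightarrow>\<^sub>C ('h \<Rightarrow>\<^sub>L 'h)) \<Rightarrow> ('a \<Rightarrow>\<^sub>C ('h \<Rightarrow>\<^sub>L 'h))" where
  "Phi U \<alpha> f = Bcontfun (\<lambda>x. op_adjoint U o\<^sub>L apply_bcontfun f (\<alpha> x) o\<^sub>L U)"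

definition weighted_op :: "('a::topological_space \<Rightarrow> ('h::complex_hilbert \<Rightarrow>\<^sub>L 'h)) \<Rightarrow>
    ('h \<Rightarrow>\<^sub>L 'h) \<Rightarrow> ('a \<Rightarrow> 'a) \<Rightarrow> ('a \<Rightarrow>\<^sub>C ('h \<Rightarrow>\<^sub>L 'h)) \<Rightarrow> ('a \<Rightarrow>\<^sub>C ('h \<Rightarrow>\<^sub>L 'h))" where
  "weighted_op w U \<alpha> f =
     (let b = (\<lambda>x. w x o\<^sub>L U) in Bcontfun (\<lambda>x. b x o\<^sub>L apply_bcontfun (Phi U \<alpha> f) x))"

lemma bcontfun_compose:
  fixes v :: "'a::topological_space \<Rightarrow> ('h::complex_hilbert \<Rightarrow>\<^sub>L 'h)"
  assumes "v \<in> bcontfun" "u \<in> bcontfun"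
  shows "(\<lambda>x. v x o\<^sub>L u x) \<in> bcontfun"
proof -
  have "continuous_on UNIV v" "continuous_on UNIV u"
    using assms by (auto simp: bcontfun_def)
  then have 1: "continuous_on UNIV (\<lambda>x. v x o\<^sub>L u x)"
    by (intro bounded_bilinear.continuous_on[OF bounded_bilinear_blinfun_compose])
  obtain B C where BC: "\<And>x. norm (v x) \<le> B" "\<And>x. norm (u x) \<le> C"
    using assms by (auto simp: bcontfun_def bounded_iff)
  have "norm (v x o\<^sub>L u x) \<le> B * C" for x
    using norm_blinfun_compose[of "v x" "u x"] mult_mono[OF BC(1)[of x] BC(2)[of x]]
      order_trans[OF norm_ge_zero BC(1)[of x]] by simp
  then have "bounded (range (\<lambda>x. v x o\<^sub>L u x))"
    by (auto simp: bounded_iff)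
  then show ?thesis
    using 1 by (simp add: bcontfun_def)
qed

lemma bcontfun_comp_continuous:
  assumes "continuous_on UNIV \<alpha>"
  shows "(\<lambda>x. apply_bcontfun f (\<alpha> x)) \<in> bcontfun"
proof -
  have "range (\<lambda>x. apply_bcontfun f (\<alpha> x)) \<subseteq> range (apply_bcontfun f)"
    by auto
  then have "bounded (range (\<lambda>x. apply_bcontfun f (\<alpha> x)))"
    using bounded_apply_bcontfun bounded_subset by blast
  moreover have "continuous_on UNIV (\<lambda>x. apply_bcontfun f (\<alpha> x))"
    by (rule continuous_on_compose2[OF continuous_on_apply_bcontfun assms subset_UNIV])
  ultimately show ?thesis
    by (simp add: bcontfun_def)
qed

lemma Phi_apply:
  assumes "continuous_on UNIV \<alpha>"
  shows "apply_bcontfun (Phi U \<alpha> f) x = op_adjoint U o\<^sub>L apply_bcontfun f (\<alpha> x) o\<^sub>L U"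
proof -
  have "(\<lambda>x. op_adjoint U o\<^sub>L apply_bcontfun f (\<alpha> x) o\<^sub>L U) \<in> bcontfun"
    by (rule bcontfun_compose[OF bcontfun_compose[OF const_bcontfun
          bcontfun_comp_continuous[OF assms]] const_bcontfun])
  then show ?thesis
    by (simp add: Phi_def Bcontfun_inverse)
qed

theorem weighted_op_apply:
  assumes "continuous_on UNIV \<alpha>" "w \<in> Cb_BH" "unitary_op U"
  shows "apply_bcontfun (weighted_op w U \<alpha> f) x = w x o\<^sub>L apply_bcontfun f (\<alpha> x) o\<^sub>L U"
proof -
  have w: "w \<in> bcontfun"
    using assms by (simp add: Cb_BH_def)
  have "apply_bcontfun (weighted_op w U \<alpha> f) x = (w x o\<^sub>L U) o\<^sub>L apply_bcontfun (Phi U \<alpha> f) x"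
    unfolding weighted_op_def Let_def
    by (subst Bcontfun_inverse)
      (rule bcontfun_compose[OF bcontfun_compose[OF w const_bcontfun] apply_bcontfun], rule refl)
  also have "\<dots> = w x o\<^sub>L apply_bcontfun f (\<alpha> x) o\<^sub>L U"
  proof (rule blinfun_eqI)
    fix h
    have "blinfun_apply U (blinfun_apply (op_adjoint U) y) = y" for y
      using unitary_op_adjoint(1)[OF assms(3)] blinfun_apply_blinfun_compose
      by (metis blinfun_apply_id_blinfun)
    then show "blinfun_apply (w x o\<^sub>L U o\<^sub>L apply_bcontfun (Phi U \<alpha> f) x) h =
        blinfun_apply (w x o\<^sub>L apply_bcontfun f (\<alpha> x) o\<^sub>L U) h"
      by (simp add: Phi_apply[OF assms(1)])
  qed
  finally show ?thesis .
qed

theorem weighted_op_bounded_linear: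
  assumes "continuous_on UNIV \<alpha>" "w \<in> Cb_BH" "unitary_op U"
  shows "bounded_linear (weighted_op w U \<alpha>)"
proof -
  obtain B where B: "\<And>x. norm (w x) \<le> B"
    using assms(2) by (auto simp: Cb_BH_def bcontfun_def bounded_iff)
  show ?thesis
  proof (rule bounded_linear_intro[where K = "B * norm U"])
    show "weighted_op w U \<alpha> (f + g) = weighted_op w U \<alpha> f + weighted_op w U \<alpha> g" for f g
      by (rule bcontfun_eqI, rule blinfun_eqI)
        (simp add: weighted_op_apply[OF assms] plus_bcontfun.rep_eq blinfun.bilinear_simps)
    show "weighted_op w U \<alpha> (r *\<^sub>R f) = r *\<^sub>R weighted_op w U \<alpha> f" for r f
      by (rule bcontfun_eqI, rule blinfun_eqI)
        (simp add: weighted_op_apply[OF assms] scaleR_bcontfun.rep_eq blinfun.bilinear_simps)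
    show "norm (weighted_op w U \<alpha> f) \<le> norm f * (B * norm U)" for f
    proof (rule norm_bound)
      fix x
      have "norm (w x o\<^sub>L apply_bcontfun f (\<alpha> x) o\<^sub>L U)
          \<le> norm (w x) * norm (apply_bcontfun f (\<alpha> x)) * norm U"
        by (meson norm_blinfun_compose mult_right_mono norm_ge_zero order_trans)
      also have "\<dots> \<le> B * norm f * norm U"
        using B[of x] norm_bounded[of f "\<alpha> x"] order_trans[OF norm_ge_zero B[of x]]
        by (intro mult_mono) auto
      finally show "norm (apply_bcontfun (weighted_op w U \<alpha> f) x) \<le> norm f * (B * norm U)"
        by (simp add: weighted_op_apply[OF assms] mult_ac)
    qed
  qed
qed

theorem weighted_op_C0:
  assumes "homeomorphism UNIV UNIV \<alpha> \<beta>" "w \<in> Cb_BH" "unitary_op U" "f \<in> C0"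
  shows "weighted_op w U \<alpha> f \<in> C0"
proof -
  have \<alpha>: "continuous_on UNIV \<alpha>" and \<beta>: "continuous_on UNIV \<beta>" and \<beta>\<alpha>: "\<And>x. \<beta> (\<alpha> x) = x"
    using assms(1) by (auto simp: homeomorphism_def)
  note app = weighted_op_apply[OF \<alpha> assms(2,3)]
  have "apply_bcontfun (weighted_op w U \<alpha> f) x \<in> compact_ops" for x
    using assms unfolding app
    by (intro compact_ops_compose_unitary compact_ops_compose_left) (auto simp: Cb_BH_def C0_def)
  moreover have "\<exists>K. compact K \<and>
      (\<forall>x. x \<notin> K \<longrightarrow> norm (apply_bcontfun (weighted_op w U \<alpha> f) x) < \<epsilon>)"
    if "\<epsilon> > 0" for \<epsilon>
  proof -
    obtain B0 where B0: "\<And>x. norm (w x) \<le> B0"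
      using assms(2) by (auto simp: Cb_BH_def bcontfun_def bounded_iff)
    define B where "B = (max B0 0 + 1) * (norm U + 1)"
    have "B > 0"
      unfolding B_def by (intro mult_pos_pos) (auto intro: add_nonneg_pos)
    with \<open>\<epsilon> > 0\<close> have "\<epsilon> / B > 0"
      by simp
    moreover have "\<forall>\<epsilon>>0. \<exists>K. compact K \<and> (\<forall>x. x \<notin> K \<longrightarrow> norm (apply_bcontfun f x) < \<epsilon>)"
      using assms(4) by (simp add: C0_def)
    ultimately obtain K
      where K: "compact K" "\<And>x. x \<notin> K \<Longrightarrow> norm (apply_bcontfun f x) < \<epsilon> / B"
      by blast
    have "norm (apply_bcontfun (weighted_op w U \<alpha> f) x) < \<epsilon>" if "x \<notin> \<beta> ` K" for x
    proof -
      have "\<alpha> x \<notin> K"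
        using that \<beta>\<alpha> by (metis imageI)
      then have less: "norm (apply_bcontfun f (\<alpha> x)) < \<epsilon> / B"
        by (rule K(2))
      have "norm (w x o\<^sub>L apply_bcontfun f (\<alpha> x) o\<^sub>L U)
          \<le> norm (w x) * norm (apply_bcontfun f (\<alpha> x)) * norm U"
        by (meson norm_blinfun_compose mult_right_mono norm_ge_zero order_trans)
      also have "\<dots> = (norm (w x) * norm U) * norm (apply_bcontfun f (\<alpha> x))"
        by simp
      also have "\<dots> \<le> B * norm (apply_bcontfun f (\<alpha> x))"
        unfolding B_def using B0[of x] by (intro mult_right_mono mult_mono) auto
      also have "\<dots> < \<epsilon>"
        using less \<open>B > 0\<close> by (simp add: field_simps)
      finally show ?thesis
        by (simp add: app)
    qed
    moreover have "compact (\<beta> ` K)"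
      by (rule compact_continuous_image[OF continuous_on_subset[OF \<beta> subset_UNIV] K(1)])
    ultimately show ?thesis
      by blast
  qed
  ultimately show ?thesis
    by (auto simp: C0_def)
qed

section \<open>Semi-transitivity\<close>

(* X is a subspace of an ambient normed space, and O and the V l are open relative to X;
   T n l is the n-th member of the l-th family. *)
definition d_semi_transitive_on :: "'x::real_normed_vector set \<Rightarrow> nat set set \<Rightarrow> nat \<Rightarrow>
    (nat \<Rightarrow> nat \<Rightarrow> 'x \<Rightarrow> 'x) \<Rightarrow> bool" where
  "d_semi_transitive_on X \<F> N T \<longleftrightarrow>
     (\<forall>\<O> V. openin (top_of_set X) \<O> \<and> \<O> \<noteq> {} \<and>
        (\<forall>l\<in>{1..N}. openin (top_of_set X) (V l) \<and> V l \<noteq> {}) \<longrightarrow>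
        (\<exists>F\<in>\<F>. \<forall>n\<in>F. \<exists>r::real. r > 0 \<and>
           \<O> \<inter> (\<Inter>l\<in>{1..N}. (\<lambda>f. r *\<^sub>R f) ` {f \<in> X. T n l f \<in> V l}) \<noteq> {}))"

end

theory Submission
  imports Defs
begin

text \<open>Write \<open>T n l\<close> for the weighted operators.  Since the weights and the maps \<open>\<alpha> n s\<close> are
  invertible, each \<open>T n s\<close> has a right inverse \<open>S n s\<close> (\<open>weighted_inv\<close>).  Given open sets, pick
  \<open>g 0\<close> in the first and \<open>g l\<close> in the \<open>l\<close>-th of the others, and try
  \<open>f = g 0 + c *\<^sub>R (\<Sum>s. S n s (g s))\<close> with a real \<open>c > 0\<close>.  Then
  \<open>T n l (f / c) = g l + T n l (g 0) / c + (\<Sum>s \<noteq> l. T n l (S n s (g s)))\<close>, so three kinds of error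
  have to be small: \<open>c * norm (S n s (g s))\<close>, \<open>norm (T n l (g 0)) / c\<close> and the mixed terms.  For the
  first two a good \<open>c\<close> exists as soon as the products \<open>norm (S n s (g s)) * norm (T n l (g 0))\<close> are
  small (\<open>d_semi_transitive_onI\<close>).

  The limits in the hypotheses concern single vectors from the dense sets and compact subsets of
  the underlying space, whereas the errors are operator norms of functions on the whole space.
  The passage rests on the density lemma \<open>controlled_dense\<close>: the \<open>g l\<close> can be chosen with compact
  support and with values whose ranges are spanned by the same finitely many vectors \<open>h i\<close> of the
  dense set.  After a substitution in the space variable, each of the three norms is bounded by
  a constant times a finite sum of suprema \<open>SUP x\<in>K. norm (W x (h i))\<close>, where \<open>W\<close> is the inverse
  weight, the transported weight \<open>w n l \<circ> inv (\<alpha> n l)\<close>, or the product of a transported weight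
  with an inverse weight (\<open>controlled_bound\<close>).  These are the suprema occurring in the hypotheses,
  and every \<open>n\<close> from some point on works.\<close>

section \<open>Complex Hilbert space geometry\<close>

lemma cinner_scaleC_right:
  fixes x y :: "'h::complex_hilbert"
  shows "cinner x (c *\<^sub>C y) = cnj c * cinner x y"
  by (metis cinner_commute cinner_scaleC_left complex_cnj_mult)

lemma cinner_self:
  fixes x :: "'h::complex_hilbert"
  shows "cinner x x = complex_of_real ((norm x)\<^sup>2)"
proof -
  have "Im (cinner x x) = 0"
    using arg_cong[OF cinner_commute[of x x], of Im] by simp
  moreover have "Re (cinner x x) = (norm x)\<^sup>2"
    by (metis inner_eq_Re_cinner power2_norm_eq_inner)
  ultimately show ?thesis
    by (simp add: complex_eq_iff)
qed

lemma norm_scaleC: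
  fixes x :: "'h::complex_hilbert"
  shows "norm (c *\<^sub>C x) = cmod c * norm x"
proof -
  have "complex_of_real ((norm (c *\<^sub>C x))\<^sup>2) = cnj c * (c * cinner x x)"
    by (simp only: cinner_self[symmetric] cinner_scaleC_left cinner_scaleC_right)
  also have "\<dots> = complex_of_real ((cmod c * norm x)\<^sup>2)"
    by (simp add: cinner_self power_mult_distrib mult_ac
        complex_norm_square[unfolded of_real_power])
  finally have "(norm (c *\<^sub>C x))\<^sup>2 = (cmod c * norm x)\<^sup>2"
    using of_real_eq_iff by blast
  then show ?thesis
    by (simp add: power2_eq_iff_nonneg)
qed

text \<open>Rotating \<open>x\<close> by a phase makes the complex product real, which reduces the claim to the
  real Cauchy--Schwarz inequality.\<close>

lemma norm_cinner_le:
  fixes x y :: "'h::complex_hilbert"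
  shows "cmod (cinner x y) \<le> norm x * norm y"
proof (cases "cinner x y = 0")
  case False
  define c where "c = cnj (sgn (cinner x y))"
  have c1: "cmod c = 1"
    using False by (simp add: c_def norm_sgn)
  have "cinner (c *\<^sub>C x) y = complex_of_real (cmod (cinner x y))"
    using False
    by (simp add: cinner_scaleC_left c_def sgn_eq complex_norm_square[symmetric]
        power2_eq_square mult.commute[of "cnj _"])
  then have "cmod (cinner x y) = inner (c *\<^sub>C x) y"
    by (simp add: inner_eq_Re_cinner)
  also have "\<dots> \<le> norm (c *\<^sub>C x) * norm y"
    by (rule norm_cauchy_schwarz)
  finally show ?thesis
    by (simp add: norm_scaleC c1)
qed simp

definition rank_one :: "'h::complex_hilbert \<Rightarrow> 'h \<Rightarrow> ('h \<Rightarrow>\<^sub>L 'h)" where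
  "rank_one u h = Blinfun (\<lambda>x. cinner x u *\<^sub>C h)"

lemma rank_one_apply [simp]: "blinfun_apply (rank_one u h) x = cinner x u *\<^sub>C h"
proof -
  have "bounded_linear (\<lambda>x. cinner x u *\<^sub>C h)"
  proof (rule bounded_linear_intro[where K = "norm u * norm h"])
    show "cinner (r *\<^sub>R x) u *\<^sub>C h = r *\<^sub>R (cinner x u *\<^sub>C h)" for r x
      by (simp add: scaleR_scaleC cinner_scaleC_left scaleC_scaleC)
    show "norm (cinner x u *\<^sub>C h) \<le> norm x * (norm u * norm h)" for x
      using mult_right_mono[OF norm_cinner_le[of x u] norm_ge_zero[of h]]
      by (simp add: norm_scaleC mult.assoc)
  qed (simp add: cinner_add_left scaleC_add_left)
  then show ?thesis
    by (simp add: rank_one_def bounded_linear_Blinfun_apply)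
qed

lemma sum_blinfun_apply: "blinfun_apply (\<Sum>i\<in>I. A i) x = (\<Sum>i\<in>I. blinfun_apply (A i) x)"
  by (induction I rule: infinite_finite_induct) (simp_all add: blinfun.add_left)

lemma BH_sum:
  fixes A :: "'i \<Rightarrow> ('h::complex_hilbert \<Rightarrow>\<^sub>L 'h)"
  assumes "\<And>i. i \<in> I \<Longrightarrow> A i \<in> BH"
  shows "(\<Sum>i\<in>I. A i) \<in> BH"
  using assms
proof (induction I rule: infinite_finite_induct)
  case (insert i I)
  then show ?case
    by (auto simp: BH_def blinfun.add_left scaleC_add_right)
next
  case empty
  interpret vector_space "scaleC :: complex \<Rightarrow> 'h \<Rightarrow> 'h"
    by (rule vector_space_scaleC)
  show ?case
    by (simp add: BH_def)
next
  case infinite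
  interpret vector_space "scaleC :: complex \<Rightarrow> 'h \<Rightarrow> 'h"
    by (rule vector_space_scaleC)
  show ?case
    by (simp add: BH_def infinite)
qed

lemma BH_rank_one: "rank_one u h \<in> BH"
  by (simp add: BH_def cinner_scaleC_left scaleC_scaleC)

lemma norm_unitary_le:
  fixes U :: "'h::complex_hilbert \<Rightarrow>\<^sub>L 'h"
  assumes "unitary_op U"
  shows "norm (A o\<^sub>L U) \<le> norm A"
proof -
  have "norm (blinfun_apply U x) = norm x" for x
    using assms by (simp add: norm_eq_sqrt_inner inner_eq_Re_cinner unitary_op_def)
  then have "norm U \<le> 1"
    by (intro norm_blinfun_bound) auto
  then show ?thesis
    using norm_blinfun_compose[of A U] mult_left_mono[of "norm U" 1 "norm A"] by simp
qed

lemma unitary_op_adjoint_unitary: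
  fixes U :: "'h::complex_hilbert \<Rightarrow>\<^sub>L 'h"
  assumes "unitary_op U"
  shows "unitary_op (op_adjoint U)"
proof -
  have UV: "blinfun_apply U (op_adjoint U x) = x" and VU: "op_adjoint U (blinfun_apply U x) = x" for x
    using unitary_op_adjoint(1,2)[OF assms] by (metis blinfun_apply_blinfun_compose blinfun_apply_id_blinfun)+
  have "cinner (op_adjoint U x) (op_adjoint U y) = cinner x y" for x y
    using assms UV unfolding unitary_op_def by metis
  moreover have "surj (blinfun_apply (op_adjoint U))"
    using VU by (metis surjI)
  ultimately show ?thesis
    using unitary_op_adjoint(3)[OF assms] by (simp add: unitary_op_def)
qed

section \<open>Finite-rank approximation of compact operators\<close>

definition tail_proj :: "('i \<Rightarrow> 'h::complex_hilbert) \<Rightarrow> 'i set \<Rightarrow> ('h \<Rightarrow>\<^sub>L 'h)" where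
  "tail_proj e I = id_blinfun - (\<Sum>i\<in>I. rank_one (e i) (e i))"

lemma tail_proj_apply: "blinfun_apply (tail_proj e I) x = x - (\<Sum>i\<in>I. cinner x (e i) *\<^sub>C e i)"
  by (simp add: tail_proj_def blinfun.diff_left sum_blinfun_apply)

lemma cinner_sum_left:
  fixes y :: "'h::complex_hilbert"
  shows "cinner (\<Sum>i\<in>I. a i) y = (\<Sum>i\<in>I. cinner (a i) y)"
proof -
  have "cinner 0 y = 0"
    using cinner_add_left[of 0 0 y] by simp
  then show ?thesis
    by (induction I rule: infinite_finite_induct) (simp_all add: cinner_add_left)
qed

text \<open>The tail of \<open>x\<close> is orthogonal to the span of the vectors \<open>e i\<close> with \<open>i\<close> in \<open>I\<close>, so Pythagoras'
  theorem makes the truncated expansion the best approximation from that span.  The choice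
  \<open>c = 0\<close> shows that tails are contractions; elements of the span close to \<open>x\<close> show that tails
  tend to zero.\<close>

lemma norm_tail_proj_le:
  fixes e :: "'i \<Rightarrow> 'h::complex_hilbert"
  assumes "orthonormal_basis e" "finite I"
  shows "norm (tail_proj e I x) \<le> norm (x - (\<Sum>i\<in>I. c i *\<^sub>C e i))"
proof -
  have on: "cinner (e i) (e j) = (if i = j then 1 else 0)" for i j
    using assms(1) by (simp add: orthonormal_basis_def)
  define t where "t = blinfun_apply (tail_proj e I) x"
  define y where "y = (\<Sum>i\<in>I. (cinner x (e i) - c i) *\<^sub>C e i)"
  have split: "x - (\<Sum>i\<in>I. c i *\<^sub>C e i) = t + y"
  proof -
    have "(\<Sum>i\<in>I. cinner x (e i) *\<^sub>C e i) = y + (\<Sum>i\<in>I. c i *\<^sub>C e i)"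
      by (simp add: y_def sum.distrib[symmetric] scaleC_add_left[symmetric])
    then show ?thesis
      by (simp add: t_def tail_proj_apply)
  qed
  have t_orth: "cinner (e j) t = 0" if "j \<in> I" for j
  proof -
    have "cinner x (e j) = cinner (t + (\<Sum>i\<in>I. cinner x (e i) *\<^sub>C e i)) (e j)"
      by (simp add: t_def tail_proj_apply)
    also have "\<dots> = cinner t (e j) + cinner x (e j)"
      using that assms(2)
      by (simp add: cinner_add_left cinner_sum_left cinner_scaleC_left on if_distrib[of "(*) _"] sum.delta cong: if_cong)
    finally have "cinner t (e j) = 0"
      by simp
    then show ?thesis
      by (subst cinner_commute) simp
  qed
  have "cinner y t = 0"
    unfolding y_def by (simp add: cinner_sum_left cinner_scaleC_left t_orth)
  then have "inner y t = 0"
    by (simp add: inner_eq_Re_cinner)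
  then have "inner t y = 0"
    by (simp only: inner_commute[of t y])
  then have "(norm (t + y))\<^sup>2 = (norm t)\<^sup>2 + (norm y)\<^sup>2"
    by (simp add: norm_add_Pythagorean orthogonal_def)
  then have "norm t \<le> norm (t + y)"
    by - (rule power2_le_imp_le, simp_all)
  then show ?thesis
    unfolding split t_def .
qed

lemma norm_tail_proj_contraction:
  fixes e :: "'i \<Rightarrow> 'h::complex_hilbert"
  assumes "orthonormal_basis e"
  shows "norm (tail_proj e I x) \<le> norm x"
proof (cases "finite I")
  case True
  interpret vector_space "scaleC :: complex \<Rightarrow> 'h \<Rightarrow> 'h"
    by (rule vector_space_scaleC)
  show ?thesis
    using norm_tail_proj_le[OF assms True, of x "\<lambda>_. 0"] by simp
qed (simp add: tail_proj_apply)

lemma tail_proj_tendsto: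
  fixes e :: "'i \<Rightarrow> 'h::complex_hilbert"
  assumes "orthonormal_basis e"
  shows "((\<lambda>I. tail_proj e I x) \<longlongrightarrow> 0) (finite_subsets_at_top UNIV)"
proof (rule tendstoI)
  fix \<epsilon> :: real assume "\<epsilon> > 0"
  interpret vector_space "scaleC :: complex \<Rightarrow> 'h \<Rightarrow> 'h"
    by (rule vector_space_scaleC)
  have "x \<in> closure (span (range e))"
    using assms by (simp add: orthonormal_basis_def)
  then obtain y where y: "y \<in> span (range e)" "dist y x < \<epsilon>"
    using \<open>\<epsilon> > 0\<close> by (meson closure_approachable)
  obtain S r where S: "finite S" "S \<subseteq> range e" and yS: "y = (\<Sum>v\<in>S. r v *\<^sub>C v)"
    using y(1) by (auto simp: span_explicit)
  have inj: "inj e"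
    using assms unfolding orthonormal_basis_def by (metis injI zero_neq_one)
  have fin: "finite (e -` S)"
    using S(1) inj by (rule finite_vimageI)
  have "dist (blinfun_apply (tail_proj e I) x) 0 < \<epsilon>" if I: "finite I" "e -` S \<subseteq> I" for I
  proof -
    have "y = (\<Sum>i\<in>e -` S. r (e i) *\<^sub>C e i)"
    proof -
      have "S = e ` (e -` S)"
        using S(2) by auto
      then have "y = (\<Sum>v\<in>e ` (e -` S). r v *\<^sub>C v)"
        using yS by simp
      also have "\<dots> = (\<Sum>i\<in>e -` S. r (e i) *\<^sub>C e i)"
        by (subst sum.reindex) (use inj in \<open>auto simp: inj_on_def\<close>)
      finally show ?thesis .
    qed
    also have "\<dots> = (\<Sum>i\<in>I. (if e i \<in> S then r (e i) else 0) *\<^sub>C e i)"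
      using I by (intro sum.mono_neutral_cong_left) auto
    finally have "norm (blinfun_apply (tail_proj e I) x) \<le> norm (x - y)"
      using norm_tail_proj_le[OF assms I(1)] by simp
    then show ?thesis
      using y(2) by (simp add: dist_norm norm_minus_commute)
  qed
  with fin show "\<forall>\<^sub>F I in finite_subsets_at_top UNIV. dist (blinfun_apply (tail_proj e I) x) 0 < \<epsilon>"
    by (auto simp: eventually_finite_subsets_at_top)
qed

text \<open>Pointwise convergence of equicontinuous maps is uniform on compact sets.  This is used
  twice: for vectors in the closure of the image of the unit ball under a compact operator, and
  then for operators in the compact range of an operator-valued function.\<close>

lemma uniformly_small_on_compact:
  fixes q :: "'i \<Rightarrow> 'x::real_normed_vector \<Rightarrow> 'y::real_normed_vector"
  assumes diff: "\<And>i x y. q i (x - y) = q i x - q i y"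
    and le: "\<And>i x. norm (q i x) \<le> norm x"
    and conv: "\<And>x. x \<in> S \<Longrightarrow> ((\<lambda>i. q i x) \<longlongrightarrow> 0) F"
    and S: "compact S" and "\<epsilon> > 0"
  shows "\<forall>\<^sub>F i in F. \<forall>x\<in>S. norm (q i x) < \<epsilon>"
proof -
  have "\<epsilon> / 2 > 0"
    using \<open>\<epsilon> > 0\<close> by simp
  then obtain k where k: "finite k" "k \<subseteq> S" "S \<subseteq> (\<Union>x\<in>k. ball x (\<epsilon> / 2))"
    using seq_compact_imp_totally_bounded[OF compact_imp_seq_compact[OF S]] by metis
  have "\<forall>\<^sub>F i in F. \<forall>y\<in>k. dist (q i y) 0 < \<epsilon> / 2"
    using k(1,2) \<open>\<epsilon> / 2 > 0\<close> by (intro eventually_ball_finite ballI tendstoD conv) auto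
  then show ?thesis
  proof eventually_elim
    case (elim i)
    show ?case
    proof
      fix x assume "x \<in> S"
      then obtain y where y: "y \<in> k" "dist y x < \<epsilon> / 2"
        using k(3) by auto
      have "norm (q i x) \<le> norm (q i (x - y)) + norm (q i y)"
        unfolding diff by norm
      also have "\<dots> < \<epsilon> / 2 + \<epsilon> / 2"
        using elim y le[of i "x - y"] by (intro add_strict_mono) (auto simp: dist_norm norm_minus_commute)
      finally show "norm (q i x) < \<epsilon>"
        by simp
    qed
  qed
qed

text \<open>Composition with a compact operator turns pointwise convergence into norm convergence.\<close>

lemma tail_proj_compact_op_tendsto:
  fixes e :: "'i \<Rightarrow> 'h::complex_hilbert"
  assumes "orthonormal_basis e" "A \<in> compact_ops"
  shows "((\<lambda>I. tail_proj e I o\<^sub>L A) \<longlongrightarrow> 0) (finite_subsets_at_top UNIV)"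
proof (rule tendstoI)
  fix \<epsilon> :: real assume "\<epsilon> > 0"
  let ?S = "closure (blinfun_apply A ` cball 0 1)"
  have "\<forall>\<^sub>F I in finite_subsets_at_top UNIV. \<forall>y\<in>?S. norm (blinfun_apply (tail_proj e I) y) < \<epsilon> / 2"
    using assms \<open>\<epsilon> > 0\<close>
    by (intro uniformly_small_on_compact norm_tail_proj_contraction tail_proj_tendsto)
      (auto simp: blinfun.diff_right compact_ops_def)
  then show "\<forall>\<^sub>F I in finite_subsets_at_top UNIV. dist (tail_proj e I o\<^sub>L A) 0 < \<epsilon>"
  proof eventually_elim
    case (elim I)
    have "norm (tail_proj e I o\<^sub>L A) \<le> \<epsilon> / 2"
    proof (rule norm_blinfun_bound)
      fix v
      show "norm (blinfun_apply (tail_proj e I o\<^sub>L A) v) \<le> \<epsilon> / 2 * norm v"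
      proof (cases "v = 0")
        case False
        define u where "u = (1 / norm v) *\<^sub>R v"
        have "norm u \<le> 1" "v = norm v *\<^sub>R u"
          using False by (auto simp: u_def)
        then have "blinfun_apply A u \<in> ?S"
          by (intro subsetD[OF closure_subset] imageI) simp
        then have "norm v * norm (blinfun_apply (tail_proj e I) (blinfun_apply A u)) \<le> norm v * (\<epsilon> / 2)"
          using elim by (intro mult_left_mono) (auto intro: less_imp_le)
        then show ?thesis
          by (subst \<open>v = norm v *\<^sub>R u\<close>) (simp add: blinfun.scaleR_right mult.commute)
      qed (simp add: blinfun.zero_right)
    qed (use \<open>\<epsilon> > 0\<close> in simp)
    then show ?case
      using \<open>\<epsilon> > 0\<close> by simp
  qed
qed

section \<open>A dense set of functions with controlled range\<close>

lemma compact_ops_add: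
  assumes "A \<in> compact_ops" "B \<in> compact_ops"
  shows "A + B \<in> compact_ops"
proof -
  let ?A = "closure (blinfun_apply A ` cball 0 1)" and ?B = "closure (blinfun_apply B ` cball 0 1)"
  have "blinfun_apply (A + B) ` cball 0 1 \<subseteq> {x + y |x y. x \<in> ?A \<and> y \<in> ?B}"
    using closure_subset[of "blinfun_apply A ` cball 0 1"] closure_subset[of "blinfun_apply B ` cball 0 1"]
    by (force simp: blinfun.add_left)
  moreover have "compact {x + y |x y. x \<in> ?A \<and> y \<in> ?B}"
    using assms by (intro compact_sums) (auto simp: compact_ops_def)
  ultimately have "compact (closure (blinfun_apply (A + B) ` cball 0 1))"
    by (rule compact_closure_subset)
  then show ?thesis
    using assms by (auto simp: compact_ops_def BH_def blinfun.add_left scaleC_add_right)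
qed

lemma compact_ops_scaleR:
  fixes A :: "'h::complex_hilbert \<Rightarrow>\<^sub>L 'h"
  assumes "A \<in> compact_ops"
  shows "r *\<^sub>R A \<in> compact_ops"
proof -
  have "r *\<^sub>R (c *\<^sub>C x) = c *\<^sub>C (r *\<^sub>R x)" for c and x :: 'h
    by (simp add: scaleR_scaleC scaleC_scaleC mult.commute)
  then have "r *\<^sub>R id_blinfun \<in> (BH :: ('h \<Rightarrow>\<^sub>L 'h) set)"
    by (simp add: BH_def blinfun.scaleR_left)
  moreover have "r *\<^sub>R A = (r *\<^sub>R id_blinfun) o\<^sub>L A"
    by (rule blinfun_eqI) (simp add: blinfun.scaleR_left)
  ultimately show ?thesis
    using compact_ops_compose_left assms by metis
qed

lemma C0_add:
  assumes "f \<in> C0" "g \<in> C0"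
  shows "f + g \<in> C0"
proof -
  have "\<exists>K. compact K \<and> (\<forall>x. x \<notin> K \<longrightarrow> norm (apply_bcontfun (f + g) x) < \<epsilon>)" if "\<epsilon> > 0" for \<epsilon>
  proof -
    have "\<epsilon> / 2 > 0"
      using that by simp
    with assms obtain K L where "compact K" "\<And>x. x \<notin> K \<Longrightarrow> norm (apply_bcontfun f x) < \<epsilon> / 2"
      and "compact L" "\<And>x. x \<notin> L \<Longrightarrow> norm (apply_bcontfun g x) < \<epsilon> / 2"
      unfolding C0_def by blast
    then have "compact (K \<union> L)" "\<And>x. x \<notin> K \<union> L \<Longrightarrow> norm (apply_bcontfun (f + g) x) < \<epsilon>"
      by (auto simp: plus_bcontfun.rep_eq intro!: norm_add_less[of _ "\<epsilon>/2" _ "\<epsilon>/2", simplified])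
    then show ?thesis
      by blast
  qed
  then show ?thesis
    using assms by (auto simp: C0_def plus_bcontfun.rep_eq intro!: compact_ops_add)
qed

lemma C0_scaleR:
  assumes "f \<in> C0"
  shows "r *\<^sub>R f \<in> C0"
proof -
  have "\<exists>K. compact K \<and> (\<forall>x. x \<notin> K \<longrightarrow> norm (apply_bcontfun (r *\<^sub>R f) x) < \<epsilon>)" if "\<epsilon> > 0" for \<epsilon>
  proof -
    have "\<epsilon> / (\<bar>r\<bar> + 1) > 0"
      using that by (intro divide_pos_pos) auto
    with assms obtain K where K: "compact K" "\<And>x. x \<notin> K \<Longrightarrow> norm (apply_bcontfun f x) < \<epsilon> / (\<bar>r\<bar> + 1)"
      unfolding C0_def by blast
    have "norm (apply_bcontfun (r *\<^sub>R f) x) < \<epsilon>" if "x \<notin> K" for x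
    proof -
      have "\<bar>r\<bar> * norm (apply_bcontfun f x) \<le> (\<bar>r\<bar> + 1) * norm (apply_bcontfun f x)"
        by (intro mult_right_mono) auto
      also have "\<dots> < \<epsilon>"
        using K(2)[OF that] by (simp add: field_simps)
      finally show ?thesis
        by (simp add: scaleR_bcontfun.rep_eq)
    qed
    with K(1) show ?thesis
      by blast
  qed
  then show ?thesis
    using assms by (auto simp: C0_def scaleR_bcontfun.rep_eq intro!: compact_ops_scaleR)
qed

lemma C0_add_sum:
  assumes "g \<in> C0" "\<And>i. i \<in> I \<Longrightarrow> f i \<in> C0"
  shows "g + (\<Sum>i\<in>I. f i) \<in> C0"
  using assms(2)
proof (induction I rule: infinite_finite_induct)
  case (insert i I)
  have "f i + (g + (\<Sum>i\<in>I. f i)) \<in> C0"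
    by (rule C0_add) (use insert in auto)
  then show ?case
    using insert by (simp add: algebra_simps)
qed (use assms(1) in simp_all)

text \<open>The last clause holds if every \<open>g x v\<close> is a combination of the finitely many vectors \<open>h i\<close> with
  coefficients of modulus at most \<open>C * norm v\<close>.  It is phrased through the effect of operators
  applied from the left because the weights enter in exactly this way.\<close>

definition controlled ::
    "'a set \<Rightarrow> 'i set \<Rightarrow> ('i \<Rightarrow> 'h) \<Rightarrow> real \<Rightarrow> ('a::topological_space \<Rightarrow>\<^sub>C ('h::complex_hilbert \<Rightarrow>\<^sub>L 'h)) \<Rightarrow> bool" where
  "controlled K I h C g \<longleftrightarrow>
     compact K \<and> finite I \<and> C \<ge> 0 \<and> (\<forall>x. x \<notin> K \<longrightarrow> apply_bcontfun g x = 0) \<and>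
     (\<forall>B\<in>BH. \<forall>x. norm (B o\<^sub>L apply_bcontfun g x) \<le> C * (\<Sum>i\<in>I. norm (blinfun_apply B (h i))))"

text \<open>The approximant is \<open>\<phi> x *\<^sub>R (Q o\<^sub>L f x)\<close>.  Here \<open>Q\<close> is the projection onto finitely many basis
  vectors with each basis vector in the range replaced by a nearby element of \<open>D\<close>; compactness
  of \<open>f ` K\<close> makes one \<open>Q\<close> work at all points.  The cut-off \<open>\<phi>\<close> is a function of the norm of \<open>f x\<close>,
  so that its support is compact because \<open>f\<close> vanishes at infinity.\<close>

lemma controlled_dense:
  fixes e :: "'i \<Rightarrow> 'h::complex_hilbert" and f :: "'a::topological_space \<Rightarrow>\<^sub>C ('h \<Rightarrow>\<^sub>L 'h)"
  assumes e: "orthonormal_basis e" and D: "closure D = UNIV" and f: "f \<in> C0" and "\<epsilon> > 0"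
  shows "\<exists>g K I h C. g \<in> C0 \<and> dist f g < \<epsilon> \<and> controlled K (I :: 'i set) h C g \<and> h ` I \<subseteq> D"
proof -
  define \<delta> where "\<delta> = \<epsilon> / 4"
  have "\<delta> > 0"
    using \<open>\<epsilon> > 0\<close> by (simp add: \<delta>_def)
  let ?f = "apply_bcontfun f"
  have fc: "?f x \<in> compact_ops" for x
    using f by (auto simp: C0_def)
  obtain K where K: "compact K" "\<And>x. x \<notin> K \<Longrightarrow> norm (?f x) < \<delta>"
    using f \<open>\<delta> > 0\<close> unfolding C0_def by blast
  have "\<forall>\<^sub>F I in finite_subsets_at_top UNIV. \<forall>A\<in>?f ` K. norm (tail_proj e I o\<^sub>L A) < \<delta>"
  proof (rule uniformly_small_on_compact)
    show "compact (?f ` K)"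
      using K(1) by (intro compact_continuous_image continuous_on_subset[OF continuous_on_apply_bcontfun]) auto
    show "tail_proj e I o\<^sub>L (A - B) = (tail_proj e I o\<^sub>L A) - (tail_proj e I o\<^sub>L B)" for I A B
      by (rule blinfun_eqI) (simp add: blinfun.diff_left blinfun.diff_right)
    show "norm (tail_proj e I o\<^sub>L A) \<le> norm A" for I A
    proof (rule norm_blinfun_bound)
      show "norm (blinfun_apply (tail_proj e I o\<^sub>L A) x) \<le> norm A * norm x" for x
        using order_trans[OF norm_tail_proj_contraction[OF e] norm_blinfun] by simp
    qed simp
    show "((\<lambda>I. tail_proj e I o\<^sub>L A) \<longlongrightarrow> 0) (finite_subsets_at_top UNIV)" if "A \<in> ?f ` K" for A
      using that fc by (intro tail_proj_compact_op_tendsto[OF e]) auto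
  qed fact
  then obtain I where I: "finite I" "\<And>x. x \<in> K \<Longrightarrow> norm (tail_proj e I o\<^sub>L ?f x) < \<delta>"
    unfolding eventually_finite_subsets_at_top by (metis imageI subset_UNIV order_refl)
  \<comment> \<open>the total error over the \<open>card I\<close> basis vectors, multiplied by \<open>norm f\<close>, is to be at most \<open>\<delta>\<close>\<close>
  define \<eta> where "\<eta> = \<delta> / ((real (card I) + 1) * (norm f + 1))"
  have "\<eta> > 0"
    using \<open>\<delta> > 0\<close> unfolding \<eta>_def by (intro divide_pos_pos mult_pos_pos add_nonneg_pos) auto
  have "\<exists>h\<in>D. dist h (e i) < \<eta>" for i
    using D \<open>\<eta> > 0\<close> by (metis UNIV_I closure_approachable)
  then obtain h where h: "\<And>i. h i \<in> D" "\<And>i. dist (h i) (e i) < \<eta>"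
    by metis
  have e1: "norm (e i) = 1" for i
  proof -
    have "complex_of_real ((norm (e i))\<^sup>2) = 1"
      using e unfolding cinner_self[symmetric] by (simp add: orthonormal_basis_def)
    then have "(norm (e i))\<^sup>2 = 1"
      using of_real_eq_1_iff by blast
    then show ?thesis
      by (simp add: power2_eq_1_iff) (metis norm_ge_zero not_one_le_zero neg_0_le_iff_le)
  qed
  define Q where "Q = (\<Sum>i\<in>I. rank_one (e i) (h i))"
  have Q_BH: "Q \<in> BH"
    unfolding Q_def by (intro BH_sum BH_rank_one)
  have coeff: "cmod (cinner (blinfun_apply (?f x) v) (e i)) \<le> norm f * norm v" for x v i
  proof -
    have "cmod (cinner (blinfun_apply (?f x) v) (e i)) \<le> norm (blinfun_apply (?f x) v)"
      using norm_cinner_le[of "blinfun_apply (?f x) v" "e i"] by (simp add: e1)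
    also have "\<dots> \<le> norm (?f x) * norm v"
      by (rule norm_blinfun)
    also have "\<dots> \<le> norm f * norm v"
      by (intro mult_right_mono norm_bounded) auto
    finally show ?thesis .
  qed
  have Qf: "norm ((Q o\<^sub>L ?f x) - ?f x) \<le> 2 * \<delta>" if "x \<in> K" for x
  proof -
    have "(Q o\<^sub>L ?f x) - ?f x = ((\<Sum>i\<in>I. rank_one (e i) (h i - e i)) o\<^sub>L ?f x) - (tail_proj e I o\<^sub>L ?f x)"
    proof (rule blinfun_eqI)
      fix v
      interpret vector_space "scaleC :: complex \<Rightarrow> 'h \<Rightarrow> 'h"
        by (rule vector_space_scaleC)
      show "blinfun_apply ((Q o\<^sub>L ?f x) - ?f x) v =
          blinfun_apply (((\<Sum>i\<in>I. rank_one (e i) (h i - e i)) o\<^sub>L ?f x) - (tail_proj e I o\<^sub>L ?f x)) v"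
        by (simp add: Q_def blinfun.diff_left sum_blinfun_apply tail_proj_apply sum_subtractf scale_right_diff_distrib)
    qed
    moreover have "norm ((\<Sum>i\<in>I. rank_one (e i) (h i - e i)) o\<^sub>L ?f x) \<le> \<delta>"
    proof (rule norm_blinfun_bound)
      fix v
      have "norm (\<Sum>i\<in>I. cinner (blinfun_apply (?f x) v) (e i) *\<^sub>C (h i - e i)) \<le> (\<Sum>i\<in>I. (norm f * norm v) * \<eta>)"
        by (intro sum_norm_le, unfold norm_scaleC dist_norm[symmetric])
          (intro mult_mono coeff less_imp_le[OF h(2)] mult_nonneg_nonneg norm_ge_zero zero_le_dist)
      also have "\<dots> = (card I * norm f * \<eta>) * norm v"
        by simp
      also have "\<dots> \<le> \<delta> * norm v"
      proof (intro mult_right_mono)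
        have "card I * norm f * \<eta> \<le> ((real (card I) + 1) * (norm f + 1)) * \<eta>"
          using \<open>\<eta> > 0\<close> by (intro mult_right_mono mult_mono) auto
        also have "\<dots> = \<delta>"
          unfolding \<eta>_def by (simp add: add_nonneg_eq_0_iff)
        finally show "card I * norm f * \<eta> \<le> \<delta>" .
      qed simp
      finally show "norm (blinfun_apply ((\<Sum>i\<in>I. rank_one (e i) (h i - e i)) o\<^sub>L ?f x) v) \<le> \<delta> * norm v"
        by (simp add: sum_blinfun_apply)
    qed (use \<open>\<delta> > 0\<close> in simp)
    ultimately show ?thesis
      using I(2)[OF that] norm_triangle_ineq4[of "(\<Sum>i\<in>I. rank_one (e i) (h i - e i)) o\<^sub>L ?f x" "tail_proj e I o\<^sub>L ?f x"]
      by simp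
  qed
  \<comment> \<open>the \<open>max\<close> avoids division by zero; \<open>\<phi> x = 0\<close> exactly when \<open>norm (f x) \<le> \<delta>\<close>, and the
     cut-off changes \<open>f\<close> by at most \<open>\<delta>\<close> everywhere\<close>
  define \<phi> where "\<phi> x = 1 - \<delta> / max (norm (?f x)) \<delta>" for x
  have \<phi>: "0 \<le> \<phi> x" "\<phi> x \<le> 1" "(1 - \<phi> x) * norm (?f x) \<le> \<delta>" for x
  proof -
    have m: "max (norm (?f x)) \<delta> > 0"
      using \<open>\<delta> > 0\<close> by simp
    then show "0 \<le> \<phi> x" "\<phi> x \<le> 1"
      using \<open>\<delta> > 0\<close> by (simp_all add: \<phi>_def)
    have "\<delta> * norm (?f x) \<le> \<delta> * max (norm (?f x)) \<delta>"
      using \<open>\<delta> > 0\<close> by (intro mult_left_mono) auto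
    with m show "(1 - \<phi> x) * norm (?f x) \<le> \<delta>"
      by (simp add: \<phi>_def pos_divide_le_eq)
  qed
  have \<phi>0: "\<phi> x = 0" if "x \<notin> K" for x
    using K(2)[OF that] \<open>\<delta> > 0\<close> by (simp add: \<phi>_def max_def)
  have c\<phi>: "continuous_on UNIV \<phi>"
    unfolding \<phi>_def using \<open>\<delta> > 0\<close>
    by (intro continuous_intros continuous_on_apply_bcontfun) (auto simp: max_def)
  define G where "G x = \<phi> x *\<^sub>R (Q o\<^sub>L ?f x)" for x
  have G: "G \<in> bcontfun"
  proof -
    have Qfb: "(\<lambda>x. Q o\<^sub>L ?f x) \<in> bcontfun"
      by (rule bcontfun_compose[OF const_bcontfun apply_bcontfun])
    then have "continuous_on UNIV G"
      unfolding G_def bcontfun_def by (intro continuous_intros c\<phi>) simp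
    moreover obtain B where B: "\<And>x. norm (Q o\<^sub>L ?f x) \<le> B"
      using Qfb by (auto simp: bcontfun_def bounded_iff)
    have "norm (G x) \<le> B" for x
      using mult_mono[OF \<phi>(2)[of x] B[of x]] \<phi>(1)[of x] by (simp add: G_def)
    then have "bounded (range G)"
      by (auto simp: bounded_iff)
    ultimately show ?thesis
      by (simp add: bcontfun_def)
  qed
  define g where "g = Bcontfun G"
  have g: "apply_bcontfun g x = \<phi> x *\<^sub>R (Q o\<^sub>L ?f x)" for x
    using G by (simp add: g_def Bcontfun_inverse G_def)
  have "g \<in> C0"
    using K(1) fc \<phi>0
    by (auto simp: C0_def g intro!: compact_ops_scaleR compact_ops_compose_left Q_BH exI[of _ K])
  moreover have "dist f g < \<epsilon>"
  proof -
    have "dist (apply_bcontfun f x) (apply_bcontfun g x) \<le> 3 * \<delta>" for x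
    proof -
      have "apply_bcontfun f x - apply_bcontfun g x = (1 - \<phi> x) *\<^sub>R ?f x - \<phi> x *\<^sub>R ((Q o\<^sub>L ?f x) - ?f x)"
        by (simp add: g algebra_simps)
      then have "norm (apply_bcontfun f x - apply_bcontfun g x)
          \<le> norm ((1 - \<phi> x) *\<^sub>R ?f x) + norm (\<phi> x *\<^sub>R ((Q o\<^sub>L ?f x) - ?f x))"
        by (simp only: norm_triangle_ineq4)
      also have "\<dots> \<le> \<delta> + 2 * \<delta>"
      proof (rule add_mono)
        show "norm ((1 - \<phi> x) *\<^sub>R ?f x) \<le> \<delta>"
          using \<phi>[of x] by simp
        show "norm (\<phi> x *\<^sub>R ((Q o\<^sub>L ?f x) - ?f x)) \<le> 2 * \<delta>"
        proof (cases "x \<in> K")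
          case True
          then show ?thesis
            using mult_mono[OF \<phi>(2)[of x] Qf[of x]] \<phi>(1)[of x] by simp
        qed (use \<phi>0 \<open>\<delta> > 0\<close> in simp)
      qed
      finally show ?thesis
        by (simp add: dist_norm)
    qed
    then have "dist f g \<le> 3 * \<delta>"
      by (rule dist_bound)
    then show ?thesis
      using \<open>\<epsilon> > 0\<close> by (simp add: \<delta>_def)
  qed
  moreover have "controlled K I h (norm f) g"
    unfolding controlled_def
  proof (intro conjI allI impI ballI)
    fix B :: "'h \<Rightarrow>\<^sub>L 'h" and x assume B: "B \<in> BH"
    show "norm (B o\<^sub>L apply_bcontfun g x) \<le> norm f * (\<Sum>i\<in>I. norm (blinfun_apply B (h i)))"
    proof (rule norm_blinfun_bound)
      fix v
      have "blinfun_apply (B o\<^sub>L apply_bcontfun g x) v =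
          \<phi> x *\<^sub>R (\<Sum>i\<in>I. cinner (blinfun_apply (?f x) v) (e i) *\<^sub>C blinfun_apply B (h i))"
        using B by (simp add: g Q_def BH_def blinfun.scaleR_left blinfun.scaleR_right sum_blinfun_apply blinfun.sum_right)
      also have "norm \<dots> \<le> 1 * norm (\<Sum>i\<in>I. cinner (blinfun_apply (?f x) v) (e i) *\<^sub>C blinfun_apply B (h i))"
        using \<phi>[of x] by (simp add: mult_left_le_one_le)
      also have "\<dots> \<le> (\<Sum>i\<in>I. (norm f * norm v) * norm (blinfun_apply B (h i)))"
        unfolding mult_1 using coeff by (intro sum_norm_le) (auto simp: norm_scaleC intro!: mult_right_mono)
      finally show "norm (blinfun_apply (B o\<^sub>L apply_bcontfun g x) v)
          \<le> norm f * (\<Sum>i\<in>I. norm (blinfun_apply B (h i))) * norm v"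
        by (simp add: sum_distrib_left sum_distrib_right mult_ac)
    qed (simp add: sum_nonneg)
  qed (use K(1) I(1) \<phi>0 g in auto)
  ultimately show ?thesis
    using h(1) by blast
qed

section \<open>A criterion for semi-transitivity\<close>

lemma ex_scaling_balancing_product:
  fixes a b \<delta> :: real
  assumes "a \<ge> 0" "b \<ge> 0" "\<delta> > 0" "a * b < \<delta>\<^sup>2"
  shows "\<exists>c>0. c * a < \<delta> \<and> b / c < \<delta>"
proof (cases "a = 0")
  case True
  have "b / \<delta> + 1 > 0"
    using assms by (intro add_nonneg_pos) auto
  with assms(3) have "b / (b / \<delta> + 1) < \<delta>"
    by (simp add: field_simps)
  with \<open>b / \<delta> + 1 > 0\<close> True assms(3) show ?thesis
    by (intro exI[of _ "b / \<delta> + 1"]) simp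
next
  case False
  then have "b / \<delta> < \<delta> / a"
    using assms by (simp add: field_simps power2_eq_square)
  then obtain c where c: "b / \<delta> < c" "c < \<delta> / a"
    using dense by blast
  have "c > 0"
    using c(1) assms by (meson divide_nonneg_pos le_less_trans)
  with c False assms show ?thesis
    by (intro exI[of _ c]) (auto simp: field_simps)
qed

text \<open>Only the product of \<open>norm (S n s)\<close> and \<open>norm (T n l x)\<close> needs to be small: adding
  \<open>c *\<^sub>R (\<Sum>s. S n s)\<close> to \<open>x\<close> and dividing the images by \<open>c\<close> leaves the errors
  \<open>c * norm (S n s)\<close> and \<open>norm (T n l x) / c\<close>, which a suitable \<open>c\<close> makes small simultaneously.
  This is where semi-transitivity, as opposed to transitivity, enters.\<close>

lemma d_semi_transitive_onI:
  fixes X :: "'x::real_normed_vector set"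
  assumes add_sum: "\<And>x y and I :: nat set. x \<in> X \<Longrightarrow> (\<And>i. i \<in> I \<Longrightarrow> y i \<in> X) \<Longrightarrow> x + (\<Sum>i\<in>I. y i) \<in> X"
    and scaleR: "\<And>r x. x \<in> X \<Longrightarrow> r *\<^sub>R x \<in> X"
    and lin: "\<And>n l. l \<in> {1..N} \<Longrightarrow> bounded_linear (T n l)"
    and maps: "\<And>n l x. l \<in> {1..N} \<Longrightarrow> x \<in> X \<Longrightarrow> T n l x \<in> X"
    and ex: "\<And>W. \<forall>l\<in>{0..N}. openin (top_of_set X) (W l) \<and> W l \<noteq> {} \<Longrightarrow>
      \<exists>y S. (\<forall>l\<in>{0..N}. y l \<in> W l) \<and>
        (\<forall>n. \<forall>s\<in>{1..N}. S n s \<in> X \<and> T n s (S n s) = y s) \<and>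
        (\<forall>s\<in>{1..N}. \<forall>l\<in>{1..N}. (\<lambda>n. norm (S n s) * norm (T n l (y 0))) \<longlonglongrightarrow> 0) \<and>
        (\<forall>s\<in>{1..N}. \<forall>l\<in>{1..N}. s \<noteq> l \<longrightarrow> (\<lambda>n. norm (T n l (S n s))) \<longlonglongrightarrow> 0)"
  shows "d_semi_transitive_on X {F. infinite F} N T"
  unfolding d_semi_transitive_on_def
proof (intro allI impI)
  fix \<O> V
  assume OV: "openin (top_of_set X) \<O> \<and> \<O> \<noteq> {} \<and>
    (\<forall>l\<in>{1..N}. openin (top_of_set X) (V l) \<and> V l \<noteq> {})"
  \<comment> \<open>indices of the families start at 1, so 0 is free for the set in which \<open>f\<close> itself has to lie\<close>
  define W where "W = V(0 := \<O>)"
  have W: "\<forall>l\<in>{0..N}. openin (top_of_set X) (W l) \<and> W l \<noteq> {}"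
    using OV by (auto simp: W_def)
  obtain y S where *: "\<forall>l\<in>{0..N}. y l \<in> W l"
    "\<forall>n. \<forall>s\<in>{1..N}. S n s \<in> X \<and> T n s (S n s) = y s"
    "\<forall>s\<in>{1..N}. \<forall>l\<in>{1..N}. (\<lambda>n. norm (S n s) * norm (T n l (y 0))) \<longlonglongrightarrow> 0"
    "\<forall>s\<in>{1..N}. \<forall>l\<in>{1..N}. s \<noteq> l \<longrightarrow> (\<lambda>n. norm (T n l (S n s))) \<longlonglongrightarrow> 0"
    using ex[OF W] by (elim exE conjE) (rule that)
  have y: "y l \<in> W l" if "l \<in> {0..N}" for l
    using *(1) that by blast
  have S: "S n s \<in> X" "T n s (S n s) = y s" if "s \<in> {1..N}" for n s
    using *(2) that by blast+
  have prod: "(\<lambda>n. norm (S n s) * norm (T n l (y 0))) \<longlonglongrightarrow> 0" if "s \<in> {1..N}" "l \<in> {1..N}" for s l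
    using *(3) that by blast
  have cross: "(\<lambda>n. norm (T n l (S n s))) \<longlonglongrightarrow> 0" if "s \<in> {1..N}" "l \<in> {1..N}" "s \<noteq> l" for s l
    using *(4) that by blast
  have "\<exists>e>0. ball (y l) e \<inter> X \<subseteq> W l" if "l \<in> {0..N}" for l
    using W that y[OF that] unfolding openin_contains_ball by blast
  then obtain \<rho> where \<rho>: "\<And>l. l \<in> {0..N} \<Longrightarrow> \<rho> l > 0 \<and> ball (y l) (\<rho> l) \<inter> X \<subseteq> W l"
    by metis
  define \<epsilon> where "\<epsilon> = Min (\<rho> ` {0..N})"
  have "\<epsilon> > 0"
    using \<rho> by (simp add: \<epsilon>_def)
  have in_W: "f \<in> W l" if "l \<in> {0..N}" "f \<in> X" "norm (f - y l) < \<epsilon>" for f l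
  proof -
    have "\<epsilon> \<le> \<rho> l"
      using that(1) by (simp add: \<epsilon>_def)
    then show ?thesis
      using \<rho>[OF that(1)] that by (auto simp: dist_norm norm_minus_commute)
  qed
  have y0: "y 0 \<in> X"
    using y[of 0] bspec[OF W, of 0] openin_imp_subset by fastforce
  define a where "a n = (\<Sum>s\<in>{1..N}. norm (S n s))" for n
  define b where "b n = (\<Sum>l\<in>{1..N}. norm (T n l (y 0)))" for n
  have "(\<lambda>n. a n * b n) \<longlonglongrightarrow> 0"
    unfolding a_def b_def sum_product by (intro tendsto_null_sum prod)
  then have ev1: "\<forall>\<^sub>F n in sequentially. a n * b n < (\<epsilon> / 2)\<^sup>2"
    by (rule order_tendstoD(2)) (use \<open>\<epsilon> > 0\<close> in simp)
  have ev2: "\<forall>\<^sub>F n in sequentially. \<forall>l\<in>{1..N}. (\<Sum>s\<in>{1..N} - {l}. norm (T n l (S n s))) < \<epsilon> / 2"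
  proof (intro eventually_ball_finite ballI)
    fix l assume l: "l \<in> {1..N}"
    have "(\<lambda>n. \<Sum>s\<in>{1..N} - {l}. norm (T n l (S n s))) \<longlonglongrightarrow> 0"
      by (intro tendsto_null_sum cross) (use l in auto)
    then show "\<forall>\<^sub>F n in sequentially. (\<Sum>s\<in>{1..N} - {l}. norm (T n l (S n s))) < \<epsilon> / 2"
      by (rule order_tendstoD(2)) (use \<open>\<epsilon> > 0\<close> in simp)
  qed simp
  from eventually_conj[OF ev1 ev2] obtain n0 where n0: "\<And>n. n \<ge> n0 \<Longrightarrow> a n * b n < (\<epsilon> / 2)\<^sup>2"
    "\<And>n l. n \<ge> n0 \<Longrightarrow> l \<in> {1..N} \<Longrightarrow> (\<Sum>s\<in>{1..N} - {l}. norm (T n l (S n s))) < \<epsilon> / 2"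
    unfolding eventually_sequentially by blast
  have "\<exists>r>0. \<O> \<inter> (\<Inter>l\<in>{1..N}. (\<lambda>f. r *\<^sub>R f) ` {f \<in> X. T n l f \<in> V l}) \<noteq> {}" if n: "n \<ge> n0" for n
  proof -
    have "a n \<ge> 0" "b n \<ge> 0"
      by (auto simp: a_def b_def intro: sum_nonneg)
    then obtain c where c: "c > 0" "c * a n < \<epsilon> / 2" "b n / c < \<epsilon> / 2"
      using ex_scaling_balancing_product[of "a n" "b n" "\<epsilon> / 2"] n0(1)[OF n] \<open>\<epsilon> > 0\<close> by auto
    define f where "f = y 0 + (\<Sum>s\<in>{1..N}. c *\<^sub>R S n s)"
    define f' where "f' = (1 / c) *\<^sub>R f"
    have "f \<in> X"
      unfolding f_def by (intro add_sum y0 scaleR S)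
    then have fX: "f \<in> X" "f' \<in> X"
      by (simp_all add: f'_def scaleR)
    have "norm (f - y 0) \<le> (\<Sum>s\<in>{1..N}. c * norm (S n s))"
      using c(1) by (auto simp: f_def intro!: sum_norm_le)
    also have "\<dots> = c * a n"
      by (simp add: a_def sum_distrib_left)
    finally have "f \<in> W 0"
      using c(2) \<open>\<epsilon> > 0\<close> fX by (intro in_W) auto
    moreover have "T n l f' \<in> W l" if l: "l \<in> {1..N}" for l
    proof (rule in_W)
      interpret bounded_linear "T n l"
        by (rule lin[OF l])
      have "T n l f' = (1 / c) *\<^sub>R T n l (y 0) + (\<Sum>s\<in>{1..N}. T n l (S n s))"
        using c(1) by (simp add: f'_def f_def scaleR add sum scaleR_right_distrib scaleR_sum_right)
      also have "(\<Sum>s\<in>{1..N}. T n l (S n s)) = y l + (\<Sum>s\<in>{1..N} - {l}. T n l (S n s))"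
        using l S(2) by (subst sum.remove[of _ l]) auto
      finally have "norm (T n l f' - y l)
          = norm ((1 / c) *\<^sub>R T n l (y 0) + (\<Sum>s\<in>{1..N} - {l}. T n l (S n s)))"
        by simp
      also have "\<dots> \<le> norm ((1 / c) *\<^sub>R T n l (y 0)) + norm (\<Sum>s\<in>{1..N} - {l}. T n l (S n s))"
        by (rule norm_triangle_ineq)
      also have "\<dots> \<le> b n / c + (\<Sum>s\<in>{1..N} - {l}. norm (T n l (S n s)))"
      proof (intro add_mono sum_norm_le order_refl)
        have "norm (T n l (y 0)) \<le> b n"
          unfolding b_def using l by (intro member_le_sum) auto
        then show "norm ((1 / c) *\<^sub>R T n l (y 0)) \<le> b n / c"
          using c(1) by (simp add: divide_right_mono)
      qed
      also have "\<dots> < \<epsilon>"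
        using c(3) n0(2)[OF n l] by linarith
      finally show "norm (T n l f' - y l) < \<epsilon>" .
    qed (use l fX maps in auto)
    ultimately have "f \<in> \<O> \<inter> (\<Inter>l\<in>{1..N}. (\<lambda>f. c *\<^sub>R f) ` {f \<in> X. T n l f \<in> V l})"
      using c(1) fX(2) by (auto simp: W_def f'_def intro!: image_eqI[of _ _ f'])
    then show ?thesis
      using c(1) by blast
  qed
  then show "\<exists>F\<in>{F. infinite F}. \<forall>n\<in>F. \<exists>r>0.
      \<O> \<inter> (\<Inter>l\<in>{1..N}. (\<lambda>f. r *\<^sub>R f) ` {f \<in> X. T n l f \<in> V l}) \<noteq> {}"
    by (intro bexI[of _ "{n0..}"]) (auto simp: infinite_Ici)
qed

section \<open>Weighted operators and their inverses\<close>

definition admissible :: "('a::topological_space \<Rightarrow> ('h::complex_hilbert \<Rightarrow>\<^sub>L 'h)) \<Rightarrow> ('h \<Rightarrow>\<^sub>L 'h) \<Rightarrow>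
    ('a \<Rightarrow> 'a) \<Rightarrow> bool" where
  "admissible w U \<alpha> \<longleftrightarrow> homeomorphism UNIV UNIV \<alpha> (inv \<alpha>) \<and> unitary_op U \<and> w \<in> Cb_BH \<and>
     (\<forall>x. invertible_op (w x)) \<and> (\<lambda>x. op_inverse (w x)) \<in> Cb_BH"

text \<open>The right inverse of a weighted operator is again a weighted operator, for the inverse
  homeomorphism, so that the general facts about weighted operators apply to it.\<close>

definition weighted_inv :: "('a::topological_space \<Rightarrow> ('h::complex_hilbert \<Rightarrow>\<^sub>L 'h)) \<Rightarrow>
    ('h \<Rightarrow>\<^sub>L 'h) \<Rightarrow> ('a \<Rightarrow> 'a) \<Rightarrow> ('a \<Rightarrow>\<^sub>C ('h \<Rightarrow>\<^sub>L 'h)) \<Rightarrow> ('a \<Rightarrow>\<^sub>C ('h \<Rightarrow>\<^sub>L 'h))" where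
  "weighted_inv w U \<alpha> = weighted_op (\<lambda>y. op_inverse (w (inv \<alpha> y))) (op_adjoint U) (inv \<alpha>)"

lemma Cb_BH_comp:
  assumes "w \<in> Cb_BH" "continuous_on UNIV \<alpha>"
  shows "(\<lambda>x. w (\<alpha> x)) \<in> Cb_BH"
proof -
  have w: "w \<in> bcontfun" "range w \<subseteq> BH"
    using assms(1) by (auto simp: Cb_BH_def)
  then show ?thesis
    using bcontfun_comp_continuous[OF assms(2), of "Bcontfun w"]
    by (auto simp: Cb_BH_def Bcontfun_inverse)
qed

lemma Cb_BH_compose:
  assumes "v \<in> Cb_BH" "u \<in> Cb_BH"
  shows "(\<lambda>x. v x o\<^sub>L u x) \<in> Cb_BH"
  using assms by (auto simp: Cb_BH_def intro!: bcontfun_compose BH_compose)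

lemma admissibleD:
  assumes "admissible w U \<alpha>"
  shows "continuous_on UNIV \<alpha>" "continuous_on UNIV (inv \<alpha>)"
    "\<alpha> (inv \<alpha> x) = x" "inv \<alpha> (\<alpha> x) = x" "unitary_op U" "w \<in> Cb_BH"
    "(\<lambda>x. op_inverse (w x)) \<in> Cb_BH" "(\<lambda>x. op_inverse (w (inv \<alpha> x))) \<in> Cb_BH"
    "unitary_op (op_adjoint U)" "w x o\<^sub>L op_inverse (w x) = id_blinfun"
proof -
  show "w x o\<^sub>L op_inverse (w x) = id_blinfun"
    using assms unfolding admissible_def invertible_op_def by (metis op_inverse_eqI)
qed (use assms in \<open>auto simp: admissible_def homeomorphism_def
      intro: unitary_op_adjoint_unitary intro!: Cb_BH_comp[of "\<lambda>x. op_inverse (w x)"]\<close>)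

lemma weighted_inv_apply:
  assumes "admissible w U \<alpha>"
  shows "apply_bcontfun (weighted_inv w U \<alpha> g) y =
    op_inverse (w (inv \<alpha> y)) o\<^sub>L apply_bcontfun g (inv \<alpha> y) o\<^sub>L op_adjoint U"
  unfolding weighted_inv_def by (rule weighted_op_apply) (rule admissibleD[OF assms])+

lemma weighted_inv_C0:
  assumes "admissible w U \<alpha>" "g \<in> C0"
  shows "weighted_inv w U \<alpha> g \<in> C0"
  unfolding weighted_inv_def
proof (rule weighted_op_C0)
  show "homeomorphism UNIV UNIV (inv \<alpha>) \<alpha>"
    using assms(1) by (auto simp: admissible_def intro: homeomorphism_symD)
qed (use assms admissibleD in auto)

lemma weighted_op_weighted_inv:
  assumes "admissible w U \<alpha>"
  shows "weighted_op w U \<alpha> (weighted_inv w U \<alpha> g) = g"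
proof (rule bcontfun_eqI, rule blinfun_eqI)
  fix x v
  have "blinfun_apply (op_adjoint U) (blinfun_apply U v) = v"
    using unitary_op_adjoint(2)[OF admissibleD(5)[OF assms]]
    by (metis blinfun_apply_blinfun_compose blinfun_apply_id_blinfun)
  moreover have "blinfun_apply (w x) (blinfun_apply (op_inverse (w x)) u) = u" for u
    using admissibleD(10)[OF assms] by (metis blinfun_apply_blinfun_compose blinfun_apply_id_blinfun)
  ultimately show "blinfun_apply (apply_bcontfun (weighted_op w U \<alpha> (weighted_inv w U \<alpha> g)) x) v
      = blinfun_apply (apply_bcontfun g x) v"
    by (simp add: weighted_op_apply admissibleD[OF assms] weighted_inv_apply[OF assms])
qed

text \<open>The supremum may be taken over any nonempty set containing the support; a product of two such
  bounds needs one common set for two functions.\<close>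

lemma controlled_bound:
  assumes g: "controlled K I h C g" and L: "K \<subseteq> L" "L \<noteq> {}" and W: "W \<in> Cb_BH"
  shows "norm (W x o\<^sub>L apply_bcontfun g x) \<le> C * (\<Sum>i\<in>I. SUP y\<in>L. norm (blinfun_apply (W y) (h i)))"
proof -
  obtain B where B: "\<And>x. norm (W x) \<le> B"
    using W by (auto simp: Cb_BH_def bcontfun_def bounded_iff)
  have le_SUP: "norm (blinfun_apply (W z) (h i)) \<le> (SUP y\<in>L. norm (blinfun_apply (W y) (h i)))"
    if "z \<in> L" for z i
  proof (rule cSUP_upper[OF that], rule bdd_aboveI2)
    show "norm (blinfun_apply (W y) (h i)) \<le> B * norm (h i)" for y
      by (rule order_trans[OF norm_blinfun mult_right_mono[OF B norm_ge_zero]])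
  qed
  have C: "C \<ge> 0"
    using g by (simp add: controlled_def)
  show ?thesis
  proof (cases "x \<in> K")
    case True
    have "norm (W x o\<^sub>L apply_bcontfun g x) \<le> C * (\<Sum>i\<in>I. norm (blinfun_apply (W x) (h i)))"
      using g W by (auto simp: controlled_def Cb_BH_def)
    also have "\<dots> \<le> C * (\<Sum>i\<in>I. SUP y\<in>L. norm (blinfun_apply (W y) (h i)))"
      using True L by (intro mult_left_mono[OF _ C] sum_mono le_SUP) auto
    finally show ?thesis .
  next
    case False
    obtain z where "z \<in> L"
      using L by blast
    have "0 \<le> (SUP y\<in>L. norm (blinfun_apply (W y) (h i)))" for i
      by (rule order_trans[OF norm_ge_zero le_SUP[OF \<open>z \<in> L\<close>]])
    moreover have "W x o\<^sub>L apply_bcontfun g x = 0"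
      using g False by (auto simp: controlled_def intro!: blinfun_eqI)
    ultimately show ?thesis
      using C by (simp add: sum_nonneg)
  qed
qed

lemma norm_weighted_op_le:
  assumes "continuous_on UNIV \<alpha>" "w \<in> Cb_BH" "unitary_op U"
    and "\<And>x. norm (w x o\<^sub>L apply_bcontfun f (\<alpha> x)) \<le> M"
  shows "norm (weighted_op w U \<alpha> f) \<le> M"
proof (rule norm_bound)
  show "norm (apply_bcontfun (weighted_op w U \<alpha> f) x) \<le> M" for x
    unfolding weighted_op_apply[OF assms(1-3)]
    by (rule order_trans[OF norm_unitary_le[OF assms(3)] assms(4)])
qed

lemma norm_weighted_op_controlled_le:
  assumes a: "admissible w U \<alpha>" and g: "controlled K I h C g" "K \<subseteq> L" "L \<noteq> {}"
  shows "norm (weighted_op w U \<alpha> g) \<le>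
    C * (\<Sum>i\<in>I. SUP y\<in>L. norm (blinfun_apply ((w \<circ> inv \<alpha>) y) (h i)))"
proof (rule norm_weighted_op_le)
  fix x
  have "(w \<circ> inv \<alpha>) \<in> Cb_BH"
    using Cb_BH_comp[OF admissibleD(6,2)[OF a]] by (simp add: comp_def)
  from controlled_bound[OF g this, of "\<alpha> x"]
  show "norm (w x o\<^sub>L apply_bcontfun g (\<alpha> x)) \<le>
      C * (\<Sum>i\<in>I. SUP y\<in>L. norm (blinfun_apply ((w \<circ> inv \<alpha>) y) (h i)))"
    by (simp add: admissibleD[OF a])
qed (use a admissibleD in auto)

lemma norm_weighted_inv_controlled_le:
  assumes a: "admissible w U \<alpha>" and g: "controlled K I h C g" "K \<subseteq> L" "L \<noteq> {}"
  shows "norm (weighted_inv w U \<alpha> g) \<le>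
    C * (\<Sum>i\<in>I. SUP x\<in>L. norm (blinfun_apply (op_inverse (w x)) (h i)))"
  unfolding weighted_inv_def
  by (rule norm_weighted_op_le)
    (use a admissibleD controlled_bound[OF g admissibleD(7)[OF a]] in auto)

text \<open>The value at \<open>x\<close> involves \<open>g\<close> at \<open>z = inv \<alpha> (\<alpha>' x)\<close>.  Expressing \<open>x\<close> through \<open>z\<close> turns the
  operator standing in front of \<open>g z\<close> into a function of \<open>z\<close> alone, as \<open>controlled_bound\<close>
  requires.\<close>

lemma norm_weighted_op_weighted_inv_le:
  assumes a: "admissible w U \<alpha>" and a': "admissible w' U' \<alpha>'"
    and g: "controlled K I h C g" "K \<subseteq> L" "L \<noteq> {}"
  shows "norm (weighted_op w' U' \<alpha>' (weighted_inv w U \<alpha> g)) \<le>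
    C * (\<Sum>i\<in>I. SUP x\<in>L. norm (blinfun_apply ((w' \<circ> inv \<alpha>' \<circ> \<alpha>) x) (blinfun_apply (op_inverse (w x)) (h i))))"
    (is "_ \<le> ?M")
proof (rule norm_weighted_op_le)
  fix x
  define z where "z = inv \<alpha> (\<alpha>' x)"
  have x: "x = inv \<alpha>' (\<alpha> z)"
    by (simp add: z_def admissibleD[OF a] admissibleD[OF a'])
  have "continuous_on UNIV (\<lambda>z. inv \<alpha>' (\<alpha> z))"
    by (rule continuous_on_compose2[OF admissibleD(2)[OF a'] admissibleD(1)[OF a]]) simp
  then have "(\<lambda>z. w' (inv \<alpha>' (\<alpha> z)) o\<^sub>L op_inverse (w z)) \<in> Cb_BH"
    by (intro Cb_BH_compose Cb_BH_comp[OF admissibleD(6)[OF a']] admissibleD(7)[OF a])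
  from controlled_bound[OF g this, of z]
  have le: "norm (w' x o\<^sub>L op_inverse (w z) o\<^sub>L apply_bcontfun g z) \<le> ?M"
    by (simp add: x)
  have "w' x o\<^sub>L apply_bcontfun (weighted_inv w U \<alpha> g) (\<alpha>' x)
      = (w' x o\<^sub>L op_inverse (w z) o\<^sub>L apply_bcontfun g z) o\<^sub>L op_adjoint U"
    by (rule blinfun_eqI) (simp add: weighted_inv_apply[OF a] z_def)
  then show "norm (w' x o\<^sub>L apply_bcontfun (weighted_inv w U \<alpha> g) (\<alpha>' x)) \<le> ?M"
    using order_trans[OF norm_unitary_le[OF admissibleD(9)[OF a]] le] by simp
qed (use a' admissibleD in auto)

section \<open>Semi-transitivity of weighted operators\<close>

theorem corollary4p6:
  fixes e :: "int \<Rightarrow> 'h::complex_hilbert"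
    and N :: nat
    and \<alpha> :: "nat \<Rightarrow> nat \<Rightarrow> 'a::t2_space \<Rightarrow> 'a"
    and U :: "nat \<Rightarrow> nat \<Rightarrow> 'h \<Rightarrow>\<^sub>L 'h"
    and w :: "nat \<Rightarrow> nat \<Rightarrow> 'a \<Rightarrow> 'h \<Rightarrow>\<^sub>L 'h"
    and D :: "nat \<Rightarrow> 'h set"
  assumes "locally_compact_space (euclidean :: 'a topology)"
    and "\<not> compact (UNIV :: 'a set)"
    and "orthonormal_basis e"
    and "\<And>n l. l \<in> {1..N} \<Longrightarrow> \<exists>\<beta>. homeomorphism UNIV UNIV (\<alpha> n l) \<beta>"
    and "\<And>n l. l \<in> {1..N} \<Longrightarrow> unitary_op (U n l)"
    and "\<And>n l. l \<in> {1..N} \<Longrightarrow> w n l \<in> Cb_BH"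
    and "\<And>n l x. l \<in> {1..N} \<Longrightarrow> invertible_op (w n l x)"
    and "\<And>n l. l \<in> {1..N} \<Longrightarrow> (\<lambda>x. op_inverse (w n l x)) \<in> Cb_BH"
    and "\<And>l. l \<in> {0..N} \<Longrightarrow> closure (D l) = UNIV"
    and "\<And>s l K h\<^sub>s h\<^sub>0. s \<in> {1..N} \<Longrightarrow> l \<in> {1..N} \<Longrightarrow> compact K \<Longrightarrow> K \<noteq> {} \<Longrightarrow>
           h\<^sub>s \<in> D s \<Longrightarrow> h\<^sub>0 \<in> D 0 \<Longrightarrow>
           (\<lambda>n. (SUP x\<in>K. norm (op_inverse (w n s x) h\<^sub>s)) *
                (SUP y\<in>K. norm ((w n l \<circ> inv (\<alpha> n l)) y h\<^sub>0))) \<longlonglongrightarrow> 0"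
    and "\<And>s l K h\<^sub>s. s \<in> {1..N} \<Longrightarrow> l \<in> {1..N} \<Longrightarrow> s \<noteq> l \<Longrightarrow> compact K \<Longrightarrow> K \<noteq> {} \<Longrightarrow>
           h\<^sub>s \<in> D s \<Longrightarrow>
           (\<lambda>n. SUP x\<in>K. norm ((w n l \<circ> inv (\<alpha> n l) \<circ> \<alpha> n s) x (op_inverse (w n s x) h\<^sub>s)))
             \<longlonglongrightarrow> 0"
  shows "d_semi_transitive_on (C0 :: ('a \<Rightarrow>\<^sub>C ('h \<Rightarrow>\<^sub>L 'h)) set) {F. infinite F} N
           (\<lambda>n l. weighted_op (w n l) (U n l) (\<alpha> n l))"
proof (rule d_semi_transitive_onI)
  have adm: "admissible (w n l) (U n l) (\<alpha> n l)" if l: "l \<in> {1..N}" for n l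
  proof -
    obtain \<beta> where \<beta>: "homeomorphism UNIV UNIV (\<alpha> n l) \<beta>"
      using assms(4)[OF l] by blast
    then have "inv (\<alpha> n l) = \<beta>"
      by (intro inv_unique_comp) (auto simp: homeomorphism_def fun_eq_iff)
    with \<beta> show ?thesis
      using assms(5-8)[OF l] by (simp add: admissible_def)
  qed
  show "bounded_linear (weighted_op (w n l) (U n l) (\<alpha> n l))" if "l \<in> {1..N}" for n l
    using admissibleD[OF adm[OF that]] by (intro weighted_op_bounded_linear)
  show "weighted_op (w n l) (U n l) (\<alpha> n l) f \<in> C0" if "l \<in> {1..N}" "f \<in> C0" for n l f
    using adm[OF that(1)] that(2) by (intro weighted_op_C0[of _ "inv (\<alpha> n l)"]) (auto simp: admissible_def)
  fix W :: "nat \<Rightarrow> ('a \<Rightarrow>\<^sub>C ('h \<Rightarrow>\<^sub>L 'h)) set"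
  assume W: "\<forall>l\<in>{0..N}. openin (top_of_set C0) (W l) \<and> W l \<noteq> {}"
  have "\<exists>g K I h C. g \<in> W l \<and> g \<in> C0 \<and> controlled K (I :: int set) h C g \<and> h ` I \<subseteq> D l"
    if l: "l \<in> {0..N}" for l
  proof -
    obtain f where f: "f \<in> W l" "f \<in> C0"
      using W l openin_imp_subset by blast
    then obtain \<epsilon> where "\<epsilon> > 0" "ball f \<epsilon> \<inter> C0 \<subseteq> W l"
      using W l unfolding openin_contains_ball by blast
    moreover obtain g K I h C where "g \<in> C0" "dist f g < \<epsilon>"
      "controlled K (I :: int set) h C g" "h ` I \<subseteq> D l"
      using controlled_dense[OF assms(3) assms(9)[OF l] f(2) \<open>\<epsilon> > 0\<close>] by (elim exE conjE) (rule that)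
    ultimately show ?thesis
      by (intro exI[of _ g] exI[of _ K] exI[of _ I] exI[of _ h] exI[of _ C]) auto
  qed
  then obtain g K I h C where g: "\<And>l. l \<in> {0..N} \<Longrightarrow> g l \<in> W l" "\<And>l. l \<in> {0..N} \<Longrightarrow> g l \<in> C0"
    and ctl: "\<And>l. l \<in> {0..N} \<Longrightarrow> controlled (K l) (I l :: int set) (h l) (C l) (g l)"
    and hD: "\<And>l. l \<in> {0..N} \<Longrightarrow> h l ` I l \<subseteq> D l"
    by metis
  \<comment> \<open>the extra point keeps \<open>L\<close> nonempty, as the suprema require\<close>
  define L where "L = insert undefined (\<Union>l\<in>{0..N}. K l)"
  have L: "compact L" "L \<noteq> {}" "\<And>l. l \<in> {0..N} \<Longrightarrow> K l \<subseteq> L"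
    using ctl by (auto simp: L_def controlled_def intro!: compact_insert compact_UN)
  define T where "T n l = weighted_op (w n l) (U n l) (\<alpha> n l)" for n l
  define S where "S n s = weighted_inv (w n s) (U n s) (\<alpha> n s) (g s)" for n s
  have prod: "(\<lambda>n. norm (S n s) * norm (T n l (g 0))) \<longlonglongrightarrow> 0"
    if s: "s \<in> {1..N}" and l: "l \<in> {1..N}" for s l
  proof -
    let ?a = "\<lambda>n i. SUP x\<in>L. norm (blinfun_apply (op_inverse (w n s x)) (h s i))"
    let ?b = "\<lambda>n j. SUP y\<in>L. norm (blinfun_apply ((w n l \<circ> inv (\<alpha> n l)) y) (h 0 j))"
    have s0: "s \<in> {0..N}" and zero: "0 \<in> {0..N}"
      using s by auto
    have "(\<lambda>n. \<Sum>i\<in>I s. \<Sum>j\<in>I 0. ?a n i * ?b n j) \<longlonglongrightarrow> 0"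
      using hD[OF s0] hD[OF zero] by (intro tendsto_null_sum assms(10)[OF s l L(1,2)]) auto
    then have lim: "(\<lambda>n. C s * C 0 * ((\<Sum>i\<in>I s. ?a n i) * (\<Sum>j\<in>I 0. ?b n j))) \<longlonglongrightarrow> 0"
      unfolding sum_product by (rule tendsto_mult_right_zero)
    have bound: "norm (norm (S n s) * norm (T n l (g 0)))
        \<le> C s * C 0 * ((\<Sum>i\<in>I s. ?a n i) * (\<Sum>j\<in>I 0. ?b n j))" for n
    proof -
      have "norm (S n s) \<le> C s * (\<Sum>i\<in>I s. ?a n i)"
        unfolding S_def by (rule norm_weighted_inv_controlled_le[OF adm[OF s] ctl[OF s0] L(3)[OF s0] L(2)])
      moreover have "norm (T n l (g 0)) \<le> C 0 * (\<Sum>j\<in>I 0. ?b n j)"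
        unfolding T_def by (rule norm_weighted_op_controlled_le[OF adm[OF l] ctl[OF zero] L(3)[OF zero] L(2)])
      ultimately have "norm (S n s) * norm (T n l (g 0))
          \<le> (C s * (\<Sum>i\<in>I s. ?a n i)) * (C 0 * (\<Sum>j\<in>I 0. ?b n j))"
        by (intro mult_mono) (auto intro: order_trans[OF norm_ge_zero])
      then show ?thesis
        by (simp add: mult_ac)
    qed
    show ?thesis
      by (rule Lim_null_comparison[OF always_eventually[OF allI[OF bound]] lim])
  qed
  have cross: "(\<lambda>n. norm (T n l (S n s))) \<longlonglongrightarrow> 0"
    if s: "s \<in> {1..N}" and l: "l \<in> {1..N}" and "s \<noteq> l" for s l
  proof -
    let ?c = "\<lambda>n i. SUP x\<in>L. norm (blinfun_apply ((w n l \<circ> inv (\<alpha> n l) \<circ> \<alpha> n s) x)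
      (blinfun_apply (op_inverse (w n s x)) (h s i)))"
    have s0: "s \<in> {0..N}"
      using s by auto
    have lim: "(\<lambda>n. C s * (\<Sum>i\<in>I s. ?c n i)) \<longlonglongrightarrow> 0"
      using hD[OF s0]
      by (intro tendsto_mult_right_zero tendsto_null_sum assms(11)[OF s l \<open>s \<noteq> l\<close> L(1,2)]) auto
    have bound: "norm (norm (T n l (S n s))) \<le> C s * (\<Sum>i\<in>I s. ?c n i)" for n
      unfolding T_def S_def
      unfolding real_norm_def abs_norm_cancel
      by (rule norm_weighted_op_weighted_inv_le[OF adm[OF s] adm[OF l] ctl[OF s0] L(3)[OF s0] L(2)])
    show ?thesis
      by (rule Lim_null_comparison[OF always_eventually[OF allI[OF bound]] lim])
  qed
  have "T n s (S n s) = g s" "S n s \<in> C0" if "s \<in> {1..N}" for n s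
    using that adm g(2) by (auto simp: T_def S_def weighted_op_weighted_inv weighted_inv_C0)
  with g(1) prod cross show "\<exists>y S. (\<forall>l\<in>{0..N}. y l \<in> W l) \<and>
      (\<forall>n. \<forall>s\<in>{1..N}. S n s \<in> C0 \<and> weighted_op (w n s) (U n s) (\<alpha> n s) (S n s) = y s) \<and>
      (\<forall>s\<in>{1..N}. \<forall>l\<in>{1..N}.
        (\<lambda>n. norm (S n s) * norm (weighted_op (w n l) (U n l) (\<alpha> n l) (y 0))) \<longlonglongrightarrow> 0) \<and>
      (\<forall>s\<in>{1..N}. \<forall>l\<in>{1..N}. s \<noteq> l \<longrightarrow>
        (\<lambda>n. norm (weighted_op (w n l) (U n l) (\<alpha> n l) (S n s))) \<longlonglongrightarrow> 0)"
    unfolding T_def by (intro exI[of _ g] exI[of _ S]) blast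
qed (auto intro: C0_add_sum C0_scaleR)

end
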